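(* Let $f(t)=\sum_{k=0}^\infty a_k t^k$ with $\{a_k\}_{k\ge 0}$ i.i.d. real standard Gaussian random variables. For every $n\ge1$ and all distinct $t_1,\dots,t_{2n}\in(-1,1)$, $$E[\mathrm{sgn} f(t_1)\,\mathrm{sgn} f(t_2)\cdots\mathrm{sgn} f(t_{2n})]=\left(\frac{2}{\pi}\right)^{n}\prod_{1\le i<j\le 2n}\mathrm{sgn}(t_j-t_i)\cdot\mathrm{Pf}\,(\mathbb{K}_{22}(t_i,t_j))_{i,j=1}^{2n}.$$ In particular, if $-1<t_1<t_2<\cdots<t_{2n}<1$, then $$E[\mathrm{sgn} f(t_1)\,\mathrm{sgn} f(t_2)\cdots\mathrm{sgn} f(t_{2n})]=\left(\frac{2}{\pi}\right)^{n}\mathrm{Pf}\,(\arcsin c(t_i,t_j))_{1\le i<j\le 2n}.$$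
   Context: For $-1<s,t<1$, $c(s,t)=\frac{\sqrt{(1-s^2)(1-t^2)}}{1-st}$ and $\mathbb{K}_{22}(s,t)=\mathrm{sgn}(t-s)\arcsin c(s,t)$; here $\mathrm{sgn}(x)=x/|x|$ for $x\ne0$ and $\mathrm{sgn}(0)=0$. The Pfaffian of a $2n\times2n$ skew-symmetric matrix $B=(b_{ij})$ is $\mathrm{Pf}(B)=\sum_\eta\epsilon(\eta)\,b_{\eta(1)\eta(2)}\cdots b_{\eta(2n-1)\eta(2n)}$, summed over permutations $\eta$ of $\{1,\dots,2n\}$ with $\eta(2i-1)<\eta(2i)$ for all $i$ and $\eta(1)<\eta(3)<\cdots<\eta(2n-1)$, where $\epsilon(\eta)$ is the signature. The Pfaffian of an upper-triangular array $(a_{ij})_{1\le i<j\le 2n}$ is the Pfaffian of the skew-symmetric matrix $(b_{ij})$ with $b_{ij}=-b_{ji}=a_{ij}$ for $i<j$ and $b_{ii}=0$. *)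

theory Defs
  imports "HOL-Probability.Probability" "HOL-Combinatorics.Permutations"
begin

definition c_kernel :: "real \<Rightarrow> real \<Rightarrow> real" where
  "c_kernel s t = sqrt ((1 - s\<^sup>2) * (1 - t\<^sup>2)) / (1 - s * t)"

definition K22 :: "real \<Rightarrow> real \<Rightarrow> real" where
  "K22 s t = sgn (t - s) * arcsin (c_kernel s t)"

text \<open>Matrices of size \<open>2n\<close> are functions on pairs of natural numbers, of which only the
  entries with both indices in \<open>{1..2 * n}\<close> are used. The first argument of \<open>pfaffian\<close> is
  \<open>n\<close>, half the size; it is the Pfaffian proper when \<open>B\<close> is skew-symmetric.\<close>

definition pfaffian_perms :: "nat \<Rightarrow> (nat \<Rightarrow> nat) set" where
  "pfaffian_perms n = {\<eta>. \<eta> permutes {1..2 * n} \<and>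
     (\<forall>i\<in>{1..n}. \<eta> (2 * i - 1) < \<eta> (2 * i)) \<and>
     (\<forall>i\<in>{1..n}. \<forall>j\<in>{1..n}. i < j \<longrightarrow> \<eta> (2 * i - 1) < \<eta> (2 * j - 1))}"

definition pfaffian :: "nat \<Rightarrow> (nat \<Rightarrow> nat \<Rightarrow> real) \<Rightarrow> real" where
  "pfaffian n B =
     (\<Sum>\<eta>\<in>pfaffian_perms n. of_int (sign \<eta>) * (\<Prod>i=1..n. B (\<eta> (2 * i - 1)) (\<eta> (2 * i))))"

definition skew_of_upper :: "(nat \<Rightarrow> nat \<Rightarrow> real) \<Rightarrow> nat \<Rightarrow> nat \<Rightarrow> real" where
  "skew_of_upper a i j = (if i < j then a i j else if j < i then - a j i else 0)"

definition pfaffian_upper :: "nat \<Rightarrow> (nat \<Rightarrow> nat \<Rightarrow> real) \<Rightarrow> real" where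
  "pfaffian_upper n a = pfaffian n (skew_of_upper a)"

text \<open>For i.i.d. standard Gaussian coefficients and \<open>\<bar>t\<bar> < 1\<close> the series converges almost
  surely; on the exceptional null set \<open>suminf\<close> has an unspecified constant value.\<close>

definition random_power_series :: "(nat \<Rightarrow> 'w \<Rightarrow> real) \<Rightarrow> 'w \<Rightarrow> real \<Rightarrow> real" where
  "random_power_series a \<omega> t = (\<Sum>k. a k \<omega> * t ^ k)"

end

theory Submission
  imports Defs "HOL-Real_Asymp.Real_Asymp"
begin

text \<open>In the coordinate \<open>t = tanh u\<close> the normalised process \<open>G u = f (tanh u) / cosh u\<close> is a stationary
  Gaussian process with covariance \<open>1 / cosh (u - v)\<close>. Given \<open>G w = x\<close> it has the law of
  \<open>x / cosh (u - w) + tanh (u - w) * G u\<close>, so that conditioning on a zero at \<open>w\<close> only multiplies the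
  signs by \<open>sgn (u - w)\<close>. Let \<open>v\<close> be the smallest of the points and \<open>U\<close> the set of the other ones.
  Differentiating \<open>E[\<Prod> sgn G]\<close> with respect to \<open>v\<close> and integrating by parts once gives the
  sum over \<open>j \<in> U\<close> of \<open>2 / pi / cosh (j - v)\<close> times a sign times the same expectation for
  \<open>U - {j}\<close>; the terms in which three points interact cancel in pairs. As everything vanishes for
  \<open>v \<longlonglongrightarrow> -\<infinity>\<close> and \<open>1 / cosh (j - v)\<close> is the derivative of \<open>arcsin (1 / cosh (j - v))\<close>, the
  expectation satisfies the expansion of a Pfaffian along one row.\<close>

section \<open>Expansion of Pfaffians\<close>

text \<open>A product of signs has no pathwise derivative in \<open>v\<close>. Writing the moment as
  an integral over the value \<open>y\<close> of the process at \<open>v\<close> moves the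
  dependence on \<open>v\<close> into thresholds \<open>- y / sinh (k - v)\<close> for the other
  points, so moments with arbitrary thresholds are studied; these are differentiable because
  integrating out one coordinate smooths the jump of its sign. Differentiating at \<open>j\<close>
  conditions on the value at \<open>j\<close>, and the resulting thresholds have the same form with
  \<open>y\<close> replaced by \<open>- (y / tanh (j - v))\<close>. The constant
  \<open>2 / pi\<close> is the square of \<open>2 * std_normal_density 0\<close>: one factor comes
  from the jump of the sign at \<open>j\<close>, after two Gaussian densities are merged by a
  rotation, the other from the jump of \<open>sgn y\<close> in the integration by parts. With
  \<open>v\<close> the smallest point all \<open>sgn (k - v)\<close> are 1, and \<open>v\<close> can
  move to -\<infinity> without meeting another point. The smallest point need not carry the smallest
  index, so the Pfaffian is expanded along an arbitrary row; the extra signs are those of the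
  product of \<open>sgn (t j - t i)\<close>.\<close>

definition index_sign :: "nat \<Rightarrow> nat set \<Rightarrow> real" where
  "index_sign j A = (\<Prod>k\<in>A. if k < j then -1 else 1)"

lemma index_sign_remove: "finite A \<Longrightarrow> k \<in> A \<Longrightarrow> index_sign j A = (if k < j then -1 else 1) * index_sign j (A - {k})"
  unfolding index_sign_def by (rule prod.remove)

lemma index_sign_square: "index_sign j A * index_sign j A = 1"
  unfolding index_sign_def prod.distrib[symmetric] by (rule prod.neutral) auto

lemma index_sign_eq_1: "(\<And>k. k \<in> A \<Longrightarrow> j \<le> k) \<Longrightarrow> index_sign j A = 1"
  unfolding index_sign_def by (rule prod.neutral) (auto simp: not_less)

lemma index_sign_image:
  assumes "strict_mono_on S h" "j \<in> S" "A \<subseteq> S"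
  shows "index_sign (h j) (h ` A) = index_sign j A"
proof -
  have "inj_on h A" using strict_mono_on_imp_inj_on[OF assms(1)] assms(3) inj_on_subset by blast
  then show ?thesis unfolding index_sign_def
    by (subst prod.reindex) (use assms in \<open>auto intro!: prod.cong simp: strict_mono_on_less subset_iff\<close>)
qed

text \<open>Row expansion taken as a definition. Working with index sets instead of an initial
  segment means that minors need no relabelling. The first argument is the number of pairs and
  carries the recursion; the value is meant for \<open>card S = 2 * n\<close>.\<close>

primrec pfaffian_set :: "nat \<Rightarrow> (nat \<Rightarrow> nat \<Rightarrow> real) \<Rightarrow> nat set \<Rightarrow> real" where
  "pfaffian_set 0 B S = 1"
| "pfaffian_set (Suc n) B S = (\<Sum>j\<in>S - {Min S}.
      index_sign j (S - {Min S, j}) * B (Min S) j * pfaffian_set n B (S - {Min S, j}))"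

lemma Min_image_strict_mono_on:
  fixes h :: "nat \<Rightarrow> nat"
  assumes "strict_mono_on S h" "finite S" "S \<noteq> {}"
  shows "Min (h ` S) = h (Min S)"
proof (rule Min_eqI)
  fix y assume "y \<in> h ` S"
  then obtain x where "x \<in> S" "y = h x" by blast
  then show "h (Min S) \<le> y"
    using strict_mono_on_leD[OF assms(1), of "Min S" x] assms by simp
qed (use assms in auto)

text \<open>The recursion sees the indices only through their order, in \<open>Min\<close> and
  \<open>index_sign\<close>, so an increasing relabelling passes through it.\<close>

lemma pfaffian_set_reindex:
  assumes "strict_mono_on S h" "finite S" "card S = 2 * n"
  shows "pfaffian_set n B (h ` S) = pfaffian_set n (\<lambda>a b. B (h a) (h b)) S"
  using assms
proof (induction n arbitrary: S)
  case (Suc n)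
  then have ne: "S \<noteq> {}" by auto
  let ?m = "Min S"
  have m: "?m \<in> S" using ne Suc.prems by auto
  have inj: "inj_on h S" using strict_mono_on_imp_inj_on Suc.prems(1) by blast
  have min: "Min (h ` S) = h ?m" using Min_image_strict_mono_on Suc.prems ne by blast
  have im: "h ` S - {h ?m} = h ` (S - {?m})"
    using inj m by (auto simp: inj_on_def)
  have im2: "h ` S - {h ?m, h j} = h ` (S - {?m, j})" if "j \<in> S" for j
    using inj m that by (auto simp: inj_on_def)
  have "pfaffian_set (Suc n) B (h ` S) = (\<Sum>j\<in>S - {?m}. index_sign (h j) (h ` S - {h ?m, h j}) * B (h ?m) (h j) * pfaffian_set n B (h ` S - {h ?m, h j}))"
    unfolding pfaffian_set.simps min im by (subst sum.reindex) (use inj in \<open>auto intro: inj_on_diff\<close>)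
  also have "\<dots> = pfaffian_set (Suc n) (\<lambda>a b. B (h a) (h b)) S"
    unfolding pfaffian_set.simps
  proof (intro sum.cong refl)
    fix j assume j: "j \<in> S - {?m}"
    have "pfaffian_set n B (h ` (S - {?m, j})) = pfaffian_set n (\<lambda>a b. B (h a) (h b)) (S - {?m, j})"
    proof (rule Suc.IH)
      show "strict_mono_on (S - {?m, j}) h" using Suc.prems(1) by (auto simp: strict_mono_on_def)
      show "card (S - {?m, j}) = 2 * n" using j m Suc.prems by (subst card_Diff_subset) auto
    qed (use Suc.prems in auto)
    then show "index_sign (h j) (h ` S - {h ?m, h j}) * B (h ?m) (h j) * pfaffian_set n B (h ` S - {h ?m, h j}) =
      index_sign j (S - {?m, j}) * B (h ?m) (h j) * pfaffian_set n (\<lambda>a b. B (h a) (h b)) (S - {?m, j})"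
      using j im2[of j] index_sign_image[OF Suc.prems(1), of j "S - {?m, j}"] by simp
  qed
  finally show ?case .
qed simp

text \<open>Induction on the size: both sides are expanded once more along the smallest index, and the
  two double sums are compared term by term.\<close>

lemma pfaffian_set_expand:
  assumes skew: "\<And>i j. B j i = - B i j" and "finite S" "card S = 2 * Suc n" "p \<in> S"
  shows "pfaffian_set (Suc n) B S = (\<Sum>j\<in>S - {p}. index_sign p (S - {p}) * index_sign j (S - {p, j}) * B p j * pfaffian_set n B (S - {p, j}))"
  using assms(2-)
proof (induction n arbitrary: S p)
  case 0
  then have "card S = 2" by simp
  then obtain m q where S: "S = {m, q}" "m < q"
    unfolding card_2_iff by (metis insert_commute linorder_neqE_nat)
  have *: "S - {m} = {q}" "S - {q} = {m}" "S - {m, q} = {}" "S - {q, m} = {}"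
    using S by auto
  have "Min S = m" using S by simp
  then have "pfaffian_set (Suc 0) B S = B m q" by (simp add: * index_sign_def)
  moreover consider "p = m" | "p = q" using 0 S(1) by auto
  then have "(\<Sum>j\<in>S - {p}. index_sign p (S - {p}) * index_sign j (S - {p, j}) * B p j * pfaffian_set 0 B (S - {p, j})) = B m q"
  proof cases
    case 2
    then show ?thesis using S(2) skew[of m q] by (simp add: * index_sign_def)
  qed (use S(2) in \<open>simp add: * index_sign_def\<close>)
  ultimately show ?case by simp
next
  case (Suc n)
  define m where "m = Min S"
  have m: "m \<in> S" unfolding m_def using Suc.prems by (intro Min_in) auto
  have mle: "m \<le> k" if "k \<in> S" for k unfolding m_def using that Suc.prems by auto
  show ?case
  proof (cases "p = m")
    case True
    have "index_sign m (S - {m}) = 1" by (rule index_sign_eq_1) (use mle in auto)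
    then show ?thesis unfolding True pfaffian_set.simps(2)[of "Suc n"] m_def[symmetric] by simp
  next
    case False
    let ?R = "S - {m, p}"
    have fR: "finite ?R" using Suc.prems by simp
    have less: "m < k" if "k \<in> S" "k \<noteq> m" for k using mle[OF that(1)] that by auto
    \<comment> \<open>The contribution in which \<open>m\<close> is paired with \<open>j\<close> and
      \<open>p\<close> with \<open>i\<close>. Both orders of expansion, \<open>m\<close> before
      \<open>p\<close> and \<open>p\<close> before \<open>m\<close>, are brought to this
      form.\<close>
    define D where "D i j = index_sign j (?R - {j, i}) * index_sign i (?R - {i, j}) * index_sign p ?R * B m j * B p i *
        pfaffian_set n B (S - {m, p, i, j}) * (if j < i then -1 else 1)" for i j
    have card: "card (S - {m, j}) = 2 * Suc n" if "j \<in> S" "j \<noteq> m" for j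
      using that m Suc.prems by (subst card_Diff_subset) auto
    have card': "card (S - {p, j}) = 2 * Suc n" if "j \<in> S" "j \<noteq> p" for j
      using that m Suc.prems by (subst card_Diff_subset) auto
    have "pfaffian_set (Suc (Suc n)) B S = (\<Sum>j\<in>insert p ?R. index_sign j (S - {m, j}) * B m j * pfaffian_set (Suc n) B (S - {m, j}))"
      using False Suc.prems unfolding pfaffian_set.simps(2)[of "Suc n"] m_def[symmetric]
      by (intro sum.cong) auto
    also have "\<dots> = index_sign p ?R * B m p * pfaffian_set (Suc n) B ?R
       + (\<Sum>j\<in>?R. index_sign j (S - {m, j}) * B m j * pfaffian_set (Suc n) B (S - {m, j}))"
      using fR by (subst sum.insert) auto
    also have "(\<Sum>j\<in>?R. index_sign j (S - {m, j}) * B m j * pfaffian_set (Suc n) B (S - {m, j}))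
       = (\<Sum>j\<in>?R. \<Sum>i\<in>?R - {j}. D i j)"
    proof (rule sum.cong[OF refl])
      fix j assume j: "j \<in> ?R"
      have R: "pfaffian_set (Suc n) B (S - {m, j}) = (\<Sum>i\<in>S - {m, j} - {p}. index_sign p (S - {m, j} - {p}) *
           index_sign i (S - {m, j} - {p, i}) * B p i * pfaffian_set n B (S - {m, j} - {p, i}))"
        using j card[of j] False Suc.prems by (intro Suc.IH) auto
      have dom: "S - {m, j} - {p} = ?R - {j}" by auto
      show "index_sign j (S - {m, j}) * B m j * pfaffian_set (Suc n) B (S - {m, j}) = (\<Sum>i\<in>?R - {j}. D i j)"
        unfolding R dom sum_distrib_left
      proof (rule sum.cong[OF refl])
        fix i assume i: "i \<in> ?R - {j}"
        have 1: "index_sign j (S - {m, j}) = (if p < j then -1 else 1) * (if i < j then -1 else 1) * index_sign j (?R - {j, i})"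
          using i j Suc.prems False
          by (subst index_sign_remove[of _ p], simp, simp, subst index_sign_remove[of _ i]) (auto intro!: arg_cong2[of _ _ _ _ index_sign])
        have 2: "index_sign p ?R = (if j < p then -1 else 1) * index_sign p (?R - {j})"
          using j fR by (subst index_sign_remove[of _ j]) auto
        have 3: "S - {m, j} - {p, i} = ?R - {i, j}" "S - {m, p, i, j} = ?R - {i, j}" by auto
        \<comment> \<open>Exactly one of \<open>p < j\<close> and \<open>j < p\<close> holds, so the
          two conditional signs of this pair multiply to -1. This -1 turns the sign attached to
          \<open>i < j\<close> into the one attached to \<open>j < i\<close> in
          \<open>D\<close>.\<close>
        show "index_sign j (S - {m, j}) * B m j * (index_sign p (?R - {j}) * index_sign i (S - {m, j} - {p, i}) * B p i * pfaffian_set n B (S - {m, j} - {p, i})) = D i j"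
          unfolding D_def 1 2 3 using i j by auto
      qed
    qed
    also have "(\<Sum>j\<in>?R. \<Sum>i\<in>?R - {j}. D i j) = (\<Sum>i\<in>?R. \<Sum>j\<in>?R - {i}. D i j)"
    proof -
      have *: "(\<Sum>a\<in>?R - {b}. f a) = (\<Sum>a\<in>?R. if a = b then 0 else f a)" for b and f :: "nat \<Rightarrow> real"
        using fR by (intro sum.mono_neutral_cong_left) auto
      show ?thesis unfolding * by (subst sum.swap) (simp add: eq_commute)
    qed
    also have "(\<Sum>i\<in>?R. \<Sum>j\<in>?R - {i}. D i j) =
       (\<Sum>i\<in>?R. index_sign p (S - {p}) * index_sign i (S - {p, i}) * B p i * pfaffian_set (Suc n) B (S - {p, i}))"
    proof (rule sum.cong[OF refl])
      fix i assume i: "i \<in> ?R"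
      have R: "pfaffian_set (Suc n) B (S - {p, i}) = (\<Sum>j\<in>S - {p, i} - {m}. index_sign m (S - {p, i} - {m}) *
           index_sign j (S - {p, i} - {m, j}) * B m j * pfaffian_set n B (S - {p, i} - {m, j}))"
        using i card'[of i] False m Suc.prems by (intro Suc.IH) auto
      have dom: "S - {p, i} - {m} = ?R - {i}" by auto
      show "(\<Sum>j\<in>?R - {i}. D i j) = index_sign p (S - {p}) * index_sign i (S - {p, i}) * B p i * pfaffian_set (Suc n) B (S - {p, i})"
        unfolding R dom sum_distrib_left
      proof (rule sum.cong[OF refl])
        fix j assume j: "j \<in> ?R - {i}"
        \<comment> \<open>The minus signs here and for \<open>p\<close> below both come from
          \<open>m\<close>, which is smaller than either index; in the product they cancel.\<close>
        have 1: "index_sign i (S - {p, i}) = - (if j < i then -1 else 1) * index_sign i (?R - {i, j})"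
          using i j m less[of i] Suc.prems False
          by (subst index_sign_remove[of _ m], simp, simp, subst index_sign_remove[of _ j]) (auto intro!: arg_cong2[of _ _ _ _ index_sign])
        have "S - {p} - {m} = ?R" by auto
        then have 2: "index_sign p (S - {p}) = - index_sign p ?R"
          using m False less[of p] Suc.prems by (subst index_sign_remove[of _ m]) auto
        have 3: "S - {p, i} - {m, j} = ?R - {j, i}" "S - {m, p, i, j} = ?R - {j, i}" by auto
        have 4: "index_sign m (?R - {i}) = 1" by (rule index_sign_eq_1) (use mle in auto)
        show "D i j = index_sign p (S - {p}) * index_sign i (S - {p, i}) * B p i * (index_sign m (?R - {i}) * index_sign j (S - {p, i} - {m, j}) * B m j * pfaffian_set n B (S - {p, i} - {m, j}))"
          unfolding D_def 1 2 3 4 by auto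
      qed
    qed
    \<comment> \<open>The pair formed by \<open>m\<close> and \<open>p\<close> becomes the summand
      \<open>i = m\<close>: the sign in \<open>B p m = - B m p\<close> cancels the one that
      \<open>m < p\<close> contributes to \<open>index_sign p (S - {p})\<close>.\<close>
    also have "index_sign p ?R * B m p * pfaffian_set (Suc n) B ?R + \<dots> =
       (\<Sum>i\<in>insert m ?R. index_sign p (S - {p}) * index_sign i (S - {p, i}) * B p i * pfaffian_set (Suc n) B (S - {p, i}))"
    proof -
      have "S - {p} - {m} = ?R" by auto
      then have 2: "index_sign p (S - {p}) = - index_sign p ?R"
        using m False less[of p] Suc.prems by (subst index_sign_remove[of _ m]) auto
      have "index_sign m ?R = 1" by (rule index_sign_eq_1) (use mle in auto)
      then show ?thesis
        using fR False 2 skew[of m p] by (subst sum.insert) (auto simp: insert_commute)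
    qed
    also have "insert m ?R = S - {p}" using m False by auto
    finally show ?thesis .
  qed
qed

text \<open>The elements of \<open>pfaffian_perms (Suc n)\<close> fix \<open>1\<close>; they are the permutations
  \<open>front_cycle i \<circ> lift_perm p\<close> with \<open>i\<close> the image of \<open>2\<close> and \<open>p \<in> pfaffian_perms n\<close>.\<close>

definition lift_perm :: "(nat \<Rightarrow> nat) \<Rightarrow> nat \<Rightarrow> nat" where
  "lift_perm p x = (if x < 2 then x else p (x - 2) + 2)"

text \<open>The cycle that brings \<open>i\<close> to position 2 and moves 2, ...,
  \<open>i - 1\<close> one place back. From position 3 on it lists the remaining indices in
  increasing order, which is how the minor without 1 and \<open>i\<close> is enumerated.\<close>

definition front_cycle :: "nat \<Rightarrow> nat \<Rightarrow> nat" where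
  "front_cycle i x = (if x = 2 then i else if 3 \<le> x \<and> x \<le> i then x - 1 else x)"

lemma lift_perm_permutes_sign:
  assumes "p permutes {1..m}"
  shows "lift_perm p permutes {1..m + 2} \<and> sign (lift_perm p) = sign p"
  using assms finite_atLeastAtMost
proof (induction rule: permutes_induct)
  case id
  have "lift_perm id = id" by (rule ext) (simp add: lift_perm_def, arith)
  show ?case unfolding \<open>lift_perm id = id\<close> by (intro conjI permutes_id refl)
next
  case (swap a b p)
  have eq: "lift_perm (Transposition.transpose a b \<circ> p) = Transposition.transpose (a + 2) (b + 2) \<circ> lift_perm p"
    by (rule ext) (auto simp: lift_perm_def Transposition.transpose_def)
  have perm: "permutation p" "permutation (lift_perm p)"
    using swap by (auto intro: permutes_imp_permutation[rotated])
  show ?case unfolding eq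
  proof
    show "Transposition.transpose (a + 2) (b + 2) \<circ> lift_perm p permutes {1..m + 2}"
      using swap by (intro permutes_compose permutes_swap_id) auto
    show "sign (Transposition.transpose (a + 2) (b + 2) \<circ> lift_perm p) = sign (Transposition.transpose a b \<circ> p)"
      using swap by (simp only: sign_compose[OF permutation_swap_id] perm sign_swap_id add_right_cancel)
  qed
qed

text \<open>Raising \<open>i\<close> by one composes with one adjacent transposition, starting from
  the identity at \<open>i = 2\<close>; the exponent \<open>i - 2\<close> has the parity of
  \<open>i\<close>.\<close>

lemma front_cycle_permutes_sign:
  assumes "2 \<le> i" "i \<le> m"
  shows "front_cycle i permutes {1..m} \<and> sign (front_cycle i) = (-1) ^ i"
  using assms
proof (induction i rule: dec_induct)
  case base
  have "front_cycle 2 = id" by (auto simp: front_cycle_def)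
  show ?case unfolding \<open>front_cycle 2 = id\<close> by (intro conjI permutes_id) simp
next
  case (step i)
  have eq: "front_cycle (Suc i) = Transposition.transpose i (Suc i) \<circ> front_cycle i"
    using step.hyps by (auto simp: front_cycle_def Transposition.transpose_def fun_eq_iff)
  have perm: "permutation (front_cycle i)"
    using step by (auto intro: permutes_imp_permutation[rotated])
  show ?case unfolding eq
  proof
    show "Transposition.transpose i (Suc i) \<circ> front_cycle i permutes {1..m}"
      using step by (intro permutes_compose permutes_swap_id) auto
    have "sign (Transposition.transpose i (Suc i) \<circ> front_cycle i) = (- 1) * (- 1) ^ i"
      using step by (subst sign_compose[OF permutation_swap_id perm]) (auto simp: sign_swap_id)
    then show "sign (Transposition.transpose i (Suc i) \<circ> front_cycle i) = (- 1) ^ Suc i" by simp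
  qed
qed

lemma front_cycle_strict_mono: "1 \<le> a \<Longrightarrow> a < b \<Longrightarrow> front_cycle i (a + 2) < front_cycle i (b + 2)"
  by (auto simp: front_cycle_def)

lemma front_cycle_less_iff:
  "1 \<le> a \<Longrightarrow> 1 \<le> b \<Longrightarrow> front_cycle i (a + 2) < front_cycle i (b + 2) \<longleftrightarrow> a < b"
  using front_cycle_strict_mono[of a b i] front_cycle_strict_mono[of b a i]
  by (metis less_asym linorder_neqE_nat)

text \<open>The index 1 cannot be the second entry of its pair, since its partner would have to be
  smaller, and it cannot open a later pair, since the opening entries increase.\<close>

lemma pfaffian_perms_first:
  assumes "\<eta> \<in> pfaffian_perms (Suc n)"
  shows "\<eta> 1 = 1"
proof -
  have \<eta>: "\<eta> permutes {1..2 * Suc n}" and 1: "\<And>i. i \<in> {1..Suc n} \<Longrightarrow> \<eta> (2 * i - 1) < \<eta> (2 * i)"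
    and 2: "\<And>i j. i \<in> {1..Suc n} \<Longrightarrow> j \<in> {1..Suc n} \<Longrightarrow> i < j \<Longrightarrow> \<eta> (2 * i - 1) < \<eta> (2 * j - 1)"
    using assms unfolding pfaffian_perms_def by blast+
  have pos: "1 \<le> \<eta> k" if "k \<in> {1..2 * Suc n}" for k
    using permutes_in_image[OF \<eta>, of k] that by simp
  obtain p where p: "p \<in> {1..2 * Suc n}" "\<eta> p = 1"
    using permutes_image[OF \<eta>] by (metis atLeastAtMost_iff imageE le_add1 le_refl mult_Suc_right numeral_2_eq_2 plus_1_eq_Suc add_Suc)
  show ?thesis
  proof (cases "even p")
    case True
    then obtain i where i: "p = 2 * i" by (auto elim: evenE)
    then have "i \<in> {1..Suc n}" using p by auto
    moreover from this have "2 * i - 1 \<in> {1..2 * Suc n}" by auto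
    ultimately show ?thesis using 1[of i] pos[of "2 * i - 1"] p i by auto
  next
    case False
    then obtain i' where "p = 2 * i' + 1" by (auto elim: oddE)
    then have i: "p = 2 * Suc i' - 1" "Suc i' \<in> {1..Suc n}" using p by auto
    show ?thesis
    proof (cases "i' = 0")
      case False
      then have "\<eta> (2 * 1 - 1) < \<eta> (2 * Suc i' - 1)" using i by (intro 2) auto
      then show ?thesis using pos[of 1] p i by auto
    qed (use i p in auto)
  qed
qed

lemma ball_1_Suc: "(\<forall>k\<in>{1..Suc n}. P k) \<longleftrightarrow> P 1 \<and> (\<forall>k\<in>{1..n}. P (Suc k))"
proof -
  have eq: "{1..Suc n} = insert 1 (Suc ` {1..n})" unfolding image_Suc_atLeastAtMost by auto
  show ?thesis unfolding eq by blast
qed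

text \<open>The new first pair consists of 1 and \<open>i\<close> and meets both order conditions
  because 1 is the least index. On the other pairs the shift followed by
  \<open>front_cycle i\<close> is increasing, so the conditions reduce to those on
  \<open>p\<close>.\<close>

lemma pfaffian_perms_lift_iff:
  assumes i: "i \<in> {2..2 * n + 2}" and p: "p permutes {1..2 * n}"
  shows "front_cycle i \<circ> lift_perm p \<in> pfaffian_perms (Suc n) \<longleftrightarrow> p \<in> pfaffian_perms n"
proof -
  let ?\<eta> = "front_cycle i \<circ> lift_perm p"
  have perm: "?\<eta> permutes {1..2 * Suc n}"
    using lift_perm_permutes_sign[OF p] front_cycle_permutes_sign[of i "2 * n + 2"] i
    by (auto intro!: permutes_compose)
  \<comment> \<open>The lift reads position 2 as \<open>p 0 + 2\<close>, so it is the fixed point 0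
    of \<open>p\<close> that makes the lift fix 2.\<close>
  have p0: "p 0 = 0" using permutes_not_in[OF p] by simp
  have ppos: "1 \<le> p k" if "k \<in> {1..2 * n}" for k
    using permutes_in_image[OF p, of k] that by simp
  have q: "1 \<le> p (2 * k - 1)" "1 \<le> p (2 * k)" if "k \<in> {1..n}" for k
  proof -
    have "2 * k - 1 \<in> {1..2 * n}" "2 * k \<in> {1..2 * n}" using that by auto
    from this[THEN ppos] show "1 \<le> p (2 * k - 1)" "1 \<le> p (2 * k)" .
  qed
  have \<eta>12: "?\<eta> 1 = 1" "?\<eta> 2 = i" using i p0 by (auto simp: lift_perm_def front_cycle_def)
  have shift: "?\<eta> (2 * Suc k - 1) = front_cycle i (p (2 * k - 1) + 2)" "?\<eta> (2 * Suc k) = front_cycle i (p (2 * k) + 2)"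
    if "1 \<le> k" for k
    using that by (auto simp: lift_perm_def Suc_diff_le numeral_2_eq_2)
  have "(\<forall>k\<in>{1..Suc n}. ?\<eta> (2 * k - 1) < ?\<eta> (2 * k)) \<longleftrightarrow> (\<forall>k\<in>{1..n}. ?\<eta> (2 * Suc k - 1) < ?\<eta> (2 * Suc k))"
  proof -
    have "?\<eta> (2 * 1 - 1) < ?\<eta> (2 * 1)" using \<eta>12 i by auto
    then show ?thesis by (simp only: ball_1_Suc simp_thms)
  qed
  also have "\<dots> \<longleftrightarrow> (\<forall>k\<in>{1..n}. p (2 * k - 1) < p (2 * k))"
    by (intro ball_cong refl) (subst shift, simp, subst shift, simp, subst front_cycle_less_iff, use q in auto)
  finally have A: "(\<forall>k\<in>{1..Suc n}. ?\<eta> (2 * k - 1) < ?\<eta> (2 * k)) \<longleftrightarrow> (\<forall>k\<in>{1..n}. p (2 * k - 1) < p (2 * k))" .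
  have "(\<forall>k\<in>{1..Suc n}. \<forall>l\<in>{1..Suc n}. k < l \<longrightarrow> ?\<eta> (2 * k - 1) < ?\<eta> (2 * l - 1)) \<longleftrightarrow>
     (\<forall>k\<in>{1..n}. \<forall>l\<in>{1..n}. k < l \<longrightarrow> ?\<eta> (2 * Suc k - 1) < ?\<eta> (2 * Suc l - 1))"
  proof -
    have "?\<eta> (2 * 1 - 1) < ?\<eta> (2 * Suc l - 1)" if "l \<in> {1..n}" for l
      using \<eta>12 shift(1)[of l] that q[of l] by (auto simp: front_cycle_def)
    then show ?thesis by (simp only: ball_1_Suc) auto
  qed
  also have "\<dots> \<longleftrightarrow> (\<forall>k\<in>{1..n}. \<forall>l\<in>{1..n}. k < l \<longrightarrow> p (2 * k - 1) < p (2 * l - 1))"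
    by (intro ball_cong refl) (subst shift, simp, subst shift, simp, subst front_cycle_less_iff, use q in auto)
  finally show ?thesis
    using A perm p unfolding pfaffian_perms_def by blast
qed

text \<open>Composing with the inverse of the cycle for \<open>i = \<eta> 2\<close> leaves a
  permutation that fixes 1 and 2, hence preserves the indices from 3 on; shifting it down by two
  gives \<open>p\<close>.\<close>

lemma pfaffian_perms_decompose:
  assumes "\<eta> \<in> pfaffian_perms (Suc n)"
  obtains i p where "i \<in> {2..2 * n + 2}" "p permutes {1..2 * n}" "\<eta> = front_cycle i \<circ> lift_perm p"
proof -
  have \<eta>: "\<eta> permutes {1..2 * n + 2}" using assms by (auto simp: pfaffian_perms_def)
  have \<eta>1: "\<eta> 1 = 1" by (rule pfaffian_perms_first[OF assms])
  define i where "i = \<eta> 2"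
  have i: "i \<in> {2..2 * n + 2}"
  proof -
    have "i \<in> {1..2 * n + 2}" unfolding i_def using permutes_in_image[OF \<eta>, of 2] by simp
    moreover have "i \<noteq> 1" unfolding i_def using \<eta>1 permutes_inj[OF \<eta>] by (metis inj_eq numeral_One numeral_eq_iff semiring_norm(85))
    ultimately show ?thesis by auto
  qed
  have fc: "front_cycle i permutes {1..2 * n + 2}" using front_cycle_permutes_sign[of i "2 * n + 2"] i by auto
  define \<sigma> where "\<sigma> = inv (front_cycle i) \<circ> \<eta>"
  have \<sigma>: "\<sigma> permutes {1..2 * n + 2}"
    unfolding \<sigma>_def by (rule permutes_compose[OF \<eta> permutes_inv[OF fc]])
  have inj: "\<sigma> x = \<sigma> y \<longleftrightarrow> x = y" for x y using permutes_inj[OF \<sigma>] by (auto simp: inj_def)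
  have \<sigma>0: "\<sigma> 0 = 0" using permutes_not_in[OF \<sigma>] by simp
  have "front_cycle i 1 = 1" "front_cycle i 2 = i" by (auto simp: front_cycle_def)
  then have \<sigma>12: "\<sigma> 1 = 1" "\<sigma> 2 = 2"
    unfolding \<sigma>_def o_def using \<eta>1 i_def permutes_inverses(2)[OF fc] by metis+
  have ge2: "2 \<le> \<sigma> x" if "2 \<le> x" for x
  proof -
    have "\<sigma> x \<noteq> \<sigma> 0" "\<sigma> x \<noteq> \<sigma> 1" using that unfolding inj by auto
    then show ?thesis unfolding \<sigma>0 \<sigma>12 by linarith
  qed
  have ge3: "3 \<le> \<sigma> x" if "3 \<le> x" for x
  proof -
    have "\<sigma> x \<noteq> \<sigma> 2" using that unfolding inj by auto
    then show ?thesis using ge2[of x] that unfolding \<sigma>12 by linarith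
  qed
  \<comment> \<open>The truncated subtraction loses nothing, as \<open>\<sigma>\<close> maps
    arguments from 2 on to values from 2 on.\<close>
  define p where "p x = \<sigma> (x + 2) - 2" for x
  have "p permutes {1..2 * n}"
  proof (rule bij_imp_permutes)
    have "p ` {1..2 * n} \<subseteq> {1..2 * n}"
    proof safe
      fix x assume "x \<in> {1..2 * n}"
      then have "3 \<le> \<sigma> (x + 2)" "\<sigma> (x + 2) \<le> 2 * n + 2"
        using ge3[of "x + 2"] permutes_in_image[OF \<sigma>, of "x + 2"] by auto
      then show "p x \<in> {1..2 * n}" unfolding p_def by auto
    qed
    moreover have "inj_on p {1..2 * n}"
    proof (rule inj_onI)
      fix x y assume "p x = p y"
      then have "\<sigma> (x + 2) = \<sigma> (y + 2)" using ge2[of "x + 2"] ge2[of "y + 2"] by (simp add: p_def)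
      then show "x = y" unfolding inj by simp
    qed
    ultimately show "bij_betw p {1..2 * n} {1..2 * n}"
      using endo_inj_surj[of "{1..2 * n}" p] by (simp add: bij_betw_def)
    fix x assume x: "x \<notin> {1..2 * n}"
    show "p x = x"
    proof (cases "x = 0")
      case True
      then show ?thesis using \<sigma>12 by (simp add: p_def numeral_2_eq_2)
    next
      case False
      then have "\<sigma> (x + 2) = x + 2" using x by (intro permutes_not_in[OF \<sigma>]) auto
      then show ?thesis by (simp add: p_def)
    qed
  qed
  moreover have "lift_perm p = \<sigma>"
  proof
    fix x show "lift_perm p x = \<sigma> x"
    proof (cases "x < 2")
      case True
      then have "x = 0 \<or> x = 1" by auto
      then show ?thesis using \<sigma>0 \<sigma>12 by (auto simp: lift_perm_def)
    next
      case False
      then have "x - 2 + 2 = x" by simp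
      moreover have "lift_perm p x = \<sigma> (x - 2 + 2) - 2 + 2"
        using False by (simp only: lift_perm_def p_def if_False)
      ultimately show ?thesis using ge2[of x] False by simp
    qed
  qed
  then have "\<eta> = front_cycle i \<circ> lift_perm p"
    unfolding \<sigma>_def using permutes_inverses(1)[OF fc] by (auto simp: fun_eq_iff)
  ultimately show ?thesis using that i by blast
qed

lemma prod_1_Suc: "(\<Prod>k=1..Suc n. f k) = f 1 * (\<Prod>k=1..n. f (Suc k))"
  by (simp add: prod.atLeast_Suc_atMost prod.shift_bounds_cl_Suc_ivl del: prod.cl_ivl_Suc)

text \<open>Reindexing along the bijection that sends \<open>(i, p)\<close> to
  \<open>front_cycle i \<circ> lift_perm p\<close>: the sign is multiplicative, the pair of 1 and
  \<open>i\<close> contributes \<open>B 1 i\<close>, and the other pairs form a Pfaffian of a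
  relabelled matrix.\<close>

lemma pfaffian_Suc:
  "pfaffian (Suc n) B = (\<Sum>i\<in>{2..2 * n + 2}. (-1) ^ i * B 1 i *
      pfaffian n (\<lambda>a b. B (front_cycle i (a + 2)) (front_cycle i (b + 2))))"
proof -
  define t where "t n B \<eta> = of_int (sign \<eta>) * (\<Prod>i=1..n. B (\<eta> (2 * i - 1)) (\<eta> (2 * i)))"
    for n and B :: "nat \<Rightarrow> nat \<Rightarrow> real" and \<eta> :: "nat \<Rightarrow> nat"
  let ?f = "\<lambda>(i, p). front_cycle i \<circ> lift_perm p"
  let ?D = "{2..2 * n + 2} \<times> pfaffian_perms n"
  have perm: "p permutes {1..2 * n}" if "p \<in> pfaffian_perms n" for p
    using that by (simp add: pfaffian_perms_def)
  have p0: "p 0 = 0" if "p \<in> pfaffian_perms n" for p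
    using permutes_not_in[OF perm[OF that]] by simp
  have inj: "inj_on ?f ?D"
  proof (rule inj_onI, clarify)
    fix i p j r
    assume A: "i \<in> {2..2 * n + 2}" "j \<in> {2..2 * n + 2}" "p \<in> pfaffian_perms n" "r \<in> pfaffian_perms n"
      and eq: "front_cycle i \<circ> lift_perm p = front_cycle j \<circ> lift_perm r"
    from fun_cong[OF eq, of 2] have ij: "i = j"
      using p0 A by (simp add: lift_perm_def front_cycle_def)
    have "inj (front_cycle i)"
      using front_cycle_permutes_sign[of i "2 * n + 2"] A permutes_inj by auto
    then have "lift_perm p = lift_perm r"
      using eq unfolding ij by (auto simp: fun_eq_iff inj_def)
    then have "lift_perm p (x + 2) = lift_perm r (x + 2)" for x by simp
    then show "i = j \<and> p = r" using ij by (auto simp: lift_perm_def)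
  qed
  have image: "?f ` ?D = pfaffian_perms (Suc n)"
  proof (intro equalityI subsetI)
    fix \<eta> assume "\<eta> \<in> ?f ` ?D"
    then show "\<eta> \<in> pfaffian_perms (Suc n)"
      using pfaffian_perms_lift_iff perm by auto
  next
    fix \<eta> assume \<eta>: "\<eta> \<in> pfaffian_perms (Suc n)"
    then obtain i p where "i \<in> {2..2 * n + 2}" "p permutes {1..2 * n}" "\<eta> = front_cycle i \<circ> lift_perm p"
      by (rule pfaffian_perms_decompose)
    then show "\<eta> \<in> ?f ` ?D"
      using \<eta> pfaffian_perms_lift_iff[of i n p] by (auto intro!: image_eqI[of _ _ "(i, p)"])
  qed
  have t_lift: "t (Suc n) B (front_cycle i \<circ> lift_perm p) =
      (-1) ^ i * B 1 i * t n (\<lambda>a b. B (front_cycle i (a + 2)) (front_cycle i (b + 2))) p"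
    if i: "i \<in> {2..2 * n + 2}" and p: "p \<in> pfaffian_perms n" for i p
  proof -
    let ?\<eta> = "front_cycle i \<circ> lift_perm p"
    have fc: "front_cycle i permutes {1..2 * n + 2}" "sign (front_cycle i) = (-1) ^ i"
      using front_cycle_permutes_sign[of i "2 * n + 2"] i by auto
    have lp: "lift_perm p permutes {1..2 * n + 2}" "sign (lift_perm p) = sign p"
      using lift_perm_permutes_sign[OF perm[OF p]] by auto
    have s: "sign ?\<eta> = (-1) ^ i * sign p"
      by (subst sign_compose) (use fc lp permutation_permutes in \<open>auto intro: permutes_imp_permutation[of "{1..2 * n + 2}"]\<close>)
    have "(\<Prod>k=1..Suc n. B (?\<eta> (2 * k - 1)) (?\<eta> (2 * k))) =
       B (?\<eta> 1) (?\<eta> 2) * (\<Prod>k=1..n. B (?\<eta> (2 * Suc k - 1)) (?\<eta> (2 * Suc k)))"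
      using prod_1_Suc[of "\<lambda>k. B (?\<eta> (2 * k - 1)) (?\<eta> (2 * k))" n] by simp
    also have "\<dots> = B 1 i * (\<Prod>k=1..n. B (front_cycle i (p (2 * k - 1) + 2)) (front_cycle i (p (2 * k) + 2)))"
    proof -
      have "?\<eta> (2 * Suc k - 1) = front_cycle i (p (2 * k - 1) + 2)" "?\<eta> (2 * Suc k) = front_cycle i (p (2 * k) + 2)"
        if "k \<in> {1..n}" for k
        using that by (auto simp: lift_perm_def Suc_diff_le numeral_2_eq_2)
      moreover have "?\<eta> 1 = 1" "?\<eta> 2 = i" using i p0[OF p] by (auto simp: lift_perm_def front_cycle_def)
      ultimately show ?thesis by simp
    qed
    finally show ?thesis unfolding t_def s by simp
  qed
  have "pfaffian (Suc n) B = (\<Sum>\<eta>\<in>?f ` ?D. t (Suc n) B \<eta>)"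
    unfolding image by (simp add: pfaffian_def t_def)
  also have "\<dots> = (\<Sum>(i, p)\<in>?D. t (Suc n) B (front_cycle i \<circ> lift_perm p))"
    by (subst sum.reindex[OF inj]) (simp add: case_prod_unfold o_def)
  also have "\<dots> = (\<Sum>i\<in>{2..2 * n + 2}. \<Sum>p\<in>pfaffian_perms n. t (Suc n) B (front_cycle i \<circ> lift_perm p))"
    by (rule sum.cartesian_product[symmetric])
  also have "\<dots> = (\<Sum>i\<in>{2..2 * n + 2}. (-1) ^ i * B 1 i *
      pfaffian n (\<lambda>a b. B (front_cycle i (a + 2)) (front_cycle i (b + 2))))"
  proof -
    have "pfaffian n C = (\<Sum>p\<in>pfaffian_perms n. t n C p)" for C
      by (simp add: pfaffian_def t_def)
    then show ?thesis by (simp add: t_lift sum_distrib_left)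
  qed
  finally show ?thesis .
qed

lemma pfaffian_eq_pfaffian_set: "pfaffian n B = pfaffian_set n B {1..2 * n}"
proof (induction n arbitrary: B)
  case 0
  have "pfaffian_perms 0 = {id}" by (auto simp: pfaffian_perms_def)
  then show ?case by (simp add: pfaffian_def)
next
  case (Suc n)
  let ?S = "{1..2 * Suc n}"
  have min: "Min ?S = 1" by (intro Min_eqI) auto
  have dom: "?S - {1} = {2..2 * n + 2}" by auto
  show ?case unfolding pfaffian_Suc pfaffian_set.simps min dom
  proof (rule sum.cong[OF refl])
    fix i assume i: "i \<in> {2..2 * n + 2}"
    let ?h = "\<lambda>a. front_cycle i (a + 2)"
    \<comment> \<open>The indices below \<open>i\<close> in this set are 2, ...,
      \<open>i - 1\<close>, an even number exactly when \<open>i\<close> is even.\<close>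
    have "index_sign i (?S - {1, i}) = (\<Prod>k\<in>{2..<i}. -1)"
      unfolding index_sign_def using i by (intro prod.mono_neutral_cong_right) auto
    also have "\<dots> = (-1) ^ i"
      using i by (simp add: minus_one_power_iff)
    finally have v: "index_sign i (?S - {1, i}) = (-1) ^ i" .
    have img: "?h ` {1..2 * n} = ?S - {1, i}"
    proof (rule card_subset_eq)
      show "?h ` {1..2 * n} \<subseteq> ?S - {1, i}" by (auto simp: front_cycle_def)
      have "inj_on ?h {1..2 * n}"
        by (intro linorder_inj_onI') (metis atLeastAtMost_iff front_cycle_strict_mono less_irrefl)
      then show "card (?h ` {1..2 * n}) = card (?S - {1, i})"
        using i by (subst card_image, simp, subst card_Diff_subset) auto
    qed auto
    have "pfaffian_set n B (?S - {1, i}) = pfaffian_set n (\<lambda>a b. B (?h a) (?h b)) {1..2 * n}"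
      unfolding img[symmetric]
    proof (rule pfaffian_set_reindex)
      show "strict_mono_on {1..2 * n} ?h"
        by (rule strict_mono_onI) (rule front_cycle_strict_mono, auto)
    qed auto
    then show "(-1) ^ i * B 1 i * pfaffian n (\<lambda>a b. B (?h a) (?h b)) = index_sign i (?S - {1, i}) * B 1 i * pfaffian_set n B (?S - {1, i})"
      unfolding v Suc.IH by simp
  qed
qed

section \<open>Sign moments and characteristic functions\<close>

text \<open>The sine integral cut off at both ends. The lower cutoff keeps \<open>1 / t\<close>
  bounded, which makes the later exchange of integrals a matter of a bounded integrand on a bounded
  interval.\<close>

lemma integral_sin_divide_cutoff:
  fixes x :: real
  shows "(LINT t|lborel. indicator {1 / (1 + real n)<..<1 + real n} t * (sin (t * x) / t))
    = sgn x * (Si ((1 + real n) * \<bar>x\<bar>) - Si (1 / (1 + real n) * \<bar>x\<bar>))"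
proof -
  let ?a = "1 / (1 + real n)" and ?b = "1 + real n"
  have le: "?a \<le> ?b" "0 \<le> ?a" "0 \<le> ?b" by (auto simp: field_simps)
  have int: "interval_lebesgue_integrable lborel (ereal 0) (ereal T) (\<lambda>t. sin (t * x) / t)" for T
    by (rule integrable_sinc')
  have "interval_lebesgue_integrable lborel (min (ereal 0) (min (ereal ?a) (ereal ?b)))
     (max (ereal 0) (max (ereal ?a) (ereal ?b))) (\<lambda>t. sin (t * x) / t)"
    using int[of ?b] le by (simp add: min_def max_def)
  from interval_integral_sum[OF this]
  have "(LBINT t=ereal ?a..ereal ?b. sin (t * x) / t)
      = (LBINT t=0..ereal ?b. sin (t * x) / t) - (LBINT t=0..ereal ?a. sin (t * x) / t)"
    by (simp add: zero_ereal_def)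
  also have "\<dots> = sgn x * (Si (?b * \<bar>x\<bar>) - Si (?a * \<bar>x\<bar>))"
    using le by (simp add: LBINT_I0c_sin_scale_divide right_diff_distrib)
  also have "(LBINT t=ereal ?a..ereal ?b. sin (t * x) / t)
      = (LINT t|lborel. indicator {?a<..<?b} t * (sin (t * x) / t))"
    using le by (simp add: interval_lebesgue_integral_le_eq set_lebesgue_integral_def)
  finally show ?thesis by simp
qed

text \<open>Fubini turns the left side into an expectation of differences of \<open>Si\<close>;
  these are bounded and tend to \<open>pi / 2\<close>, so dominated convergence applies. The bounded
  factor \<open>A\<close> is there to carry the signs already introduced together with an
  exponential.\<close>

lemma (in prob_space) sgn_fourier_limit:
  fixes A :: "'a \<Rightarrow> complex" and X :: "'a \<Rightarrow> real"
  assumes [measurable]: "A \<in> borel_measurable M" "X \<in> borel_measurable M"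
    and A: "\<And>\<omega>. norm (A \<omega>) \<le> 1"
  shows "(\<lambda>n. (LINT t|lborel. of_real (indicator {1 / (1 + real n)<..<1 + real n} t / t) *
            (LINT \<omega>|M. A \<omega> * of_real (sin (t * X \<omega>)))))
     \<longlonglongrightarrow> of_real (pi / 2) * (LINT \<omega>|M. A \<omega> * of_real (sgn (X \<omega>)))"
proof -
  interpret P: pair_sigma_finite lborel M ..
  obtain B where B: "\<And>T. \<bar>Si T\<bar> \<le> B" using bounded_Si by blast
  have swap: "(LINT t|lborel. of_real (indicator {1 / (1 + real n)<..<1 + real n} t / t) *
            (LINT \<omega>|M. A \<omega> * of_real (sin (t * X \<omega>))))
     = (LINT \<omega>|M. A \<omega> * of_real (sgn (X \<omega>) *
          (Si ((1 + real n) * \<bar>X \<omega>\<bar>) - Si (1 / (1 + real n) * \<bar>X \<omega>\<bar>))))" (is "?L = ?R") for n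
  proof -
    let ?I = "{1 / (1 + real n)<..<1 + real n}"
    have int: "integrable (lborel \<Otimes>\<^sub>M M) (\<lambda>(t, \<omega>). of_real (indicator ?I t / t) *
       (A \<omega> * of_real (sin (t * X \<omega>))))"
    proof (rule P.Fubini_integrable)
      let ?f = "\<lambda>(t, \<omega>). of_real (indicator ?I t / t) * (A \<omega> * of_real (sin (t * X \<omega>)))"
      have bd: "norm (?f (t, \<omega>)) \<le> indicator ?I t * (1 + real n)" for t \<omega>
      proof (cases "t \<in> ?I")
        case True
        have "0 < 1 / (1 + real n)" by simp
        moreover have "1 / (1 + real n) < t" using True by simp
        ultimately have t: "t > 0" by (rule less_trans)
        moreover have "1 < t * (1 + real n)"
          using True by (simp add: pos_divide_less_eq)
        ultimately have t': "1 / t \<le> 1 + real n"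
          by (simp add: pos_divide_le_eq mult.commute)
        have "norm (?f (t, \<omega>)) = (1 / t) * (norm (A \<omega>) * \<bar>sin (t * X \<omega>)\<bar>)"
          using True t by (simp add: norm_mult norm_divide)
        also have "\<dots> \<le> (1 + real n) * (1 * 1)"
          by (intro mult_mono t' A) auto
        finally show ?thesis using True by simp
      qed simp
      show "?f \<in> borel_measurable (lborel \<Otimes>\<^sub>M M)" by measurable
      show "AE t in lborel. integrable M (\<lambda>\<omega>. ?f (t, \<omega>))"
      proof (rule AE_I2)
        fix t
        have "norm (?f (t, \<omega>)) \<le> 1 + real n" for \<omega>
          by (rule order_trans[OF bd]) (auto split: split_indicator)
        then show "integrable M (\<lambda>\<omega>. ?f (t, \<omega>))"
          unfolding prod.case by (intro integrable_const_bound[OF AE_I2]) (assumption, measurable)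
      qed
      show "integrable lborel (\<lambda>t. LINT \<omega>|M. norm (?f (t, \<omega>)))"
      proof (rule Bochner_Integration.integrable_bound)
        have "1 / (1 + real n) \<le> 1 + real n" by (auto simp: field_simps)
        then show "integrable lborel (\<lambda>t. indicator ?I t * (1 + real n))"
          by (intro integrable_mult_left integrable_real_indicator) (simp_all add: emeasure_lborel_Ioo)
        show "AE t in lborel. norm (LINT \<omega>|M. norm (?f (t, \<omega>))) \<le> norm (indicator ?I t * (1 + real n))"
        proof (intro AE_I2)
          fix t
          have "\<bar>LINT \<omega>|M. norm (?f (t, \<omega>))\<bar> = (LINT \<omega>|M. norm (?f (t, \<omega>)))"
            by (intro abs_of_nonneg integral_nonneg_AE) auto
          also have "\<dots> \<le> (LINT \<omega>|M. indicator ?I t * (1 + real n))"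
            by (intro integral_mono' bd) auto
          finally show "norm (LINT \<omega>|M. norm (?f (t, \<omega>))) \<le> norm (indicator ?I t * (1 + real n))"
            by (simp add: prob_space)
        qed
      qed measurable
    qed
    have "?L = (LINT t|lborel. LINT \<omega>|M. of_real (indicator ?I t / t) * (A \<omega> * of_real (sin (t * X \<omega>))))"
      by simp
    also have "\<dots> = (LINT \<omega>|M. LINT t|lborel. of_real (indicator ?I t / t) * (A \<omega> * of_real (sin (t * X \<omega>))))"
      by (rule P.Fubini_integral[OF int, symmetric])
    also have "\<dots> = (LINT \<omega>|M. LINT t|lborel. A \<omega> * of_real (indicator ?I t * (sin (t * X \<omega>) / t)))"
      by (intro Bochner_Integration.integral_cong) auto
    also have "\<dots> = (LINT \<omega>|M. A \<omega> * of_real (LINT t|lborel. indicator ?I t * (sin (t * X \<omega>) / t)))"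
      by (simp only: integral_mult_right_zero integral_complex_of_real)
    also have "\<dots> = ?R"
      by (subst integral_sin_divide_cutoff) simp
    finally show ?thesis .
  qed
  have "(\<lambda>n. (LINT \<omega>|M. A \<omega> * of_real (sgn (X \<omega>) *
          (Si ((1 + real n) * \<bar>X \<omega>\<bar>) - Si (1 / (1 + real n) * \<bar>X \<omega>\<bar>)))))
     \<longlonglongrightarrow> (LINT \<omega>|M. A \<omega> * of_real (sgn (X \<omega>) * (pi / 2)))"
  proof (rule integral_dominated_convergence[where w="\<lambda>_. 2 * B"])
    show "AE \<omega> in M. (\<lambda>n. A \<omega> * of_real (sgn (X \<omega>) *
          (Si ((1 + real n) * \<bar>X \<omega>\<bar>) - Si (1 / (1 + real n) * \<bar>X \<omega>\<bar>))))
      \<longlonglongrightarrow> A \<omega> * of_real (sgn (X \<omega>) * (pi / 2))"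
    proof (intro AE_I2)
      fix \<omega>
      have 1: "filterlim (\<lambda>n. 1 + real n) at_top sequentially"
        by (intro filterlim_tendsto_add_at_top[OF tendsto_const filterlim_real_sequentially])
      have 2: "(\<lambda>n. Si (1 / (1 + real n) * \<bar>X \<omega>\<bar>)) \<longlonglongrightarrow> Si 0"
      proof (rule isCont_tendsto_compose[OF isCont_Si])
        have "(\<lambda>n. 1 / (1 + real n)) \<longlonglongrightarrow> 0"
          by (rule real_tendsto_divide_at_top[OF tendsto_const 1])
        from tendsto_mult_left_zero[OF this, of "\<bar>X \<omega>\<bar>"]
        show "(\<lambda>n. 1 / (1 + real n) * \<bar>X \<omega>\<bar>) \<longlonglongrightarrow> 0" by simp
      qed
      have "(\<lambda>n. sgn (X \<omega>) * (Si ((1 + real n) * \<bar>X \<omega>\<bar>) - Si (1 / (1 + real n) * \<bar>X \<omega>\<bar>)))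
         \<longlonglongrightarrow> sgn (X \<omega>) * (pi / 2)"
      \<comment> \<open>On a zero of \<open>X\<close> the sine integrals do not approach
        \<open>pi / 2\<close>; there the limit is correct because \<open>sgn 0 = 0\<close>.\<close>
      proof (cases "X \<omega> = 0")
        case False
        then have "filterlim (\<lambda>n. (1 + real n) * \<bar>X \<omega>\<bar>) at_top sequentially"
          by (intro filterlim_at_top_mult_tendsto_pos[OF tendsto_const _ 1]) auto
        from filterlim_compose[OF Si_at_top this] 2
        have "(\<lambda>n. sgn (X \<omega>) * (Si ((1 + real n) * \<bar>X \<omega>\<bar>) - Si (1 / (1 + real n) * \<bar>X \<omega>\<bar>)))
           \<longlonglongrightarrow> sgn (X \<omega>) * (pi / 2 - Si 0)"
          by (intro tendsto_intros)
        moreover have "Si 0 = 0" by (simp add: Si_def zero_ereal_def)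
        ultimately show ?thesis by simp
      qed simp
      then show "(\<lambda>n. A \<omega> * of_real (sgn (X \<omega>) *
          (Si ((1 + real n) * \<bar>X \<omega>\<bar>) - Si (1 / (1 + real n) * \<bar>X \<omega>\<bar>))))
      \<longlonglongrightarrow> A \<omega> * of_real (sgn (X \<omega>) * (pi / 2))"
        by (rule tendsto_mult[OF tendsto_const tendsto_of_real])
    qed
    show "AE \<omega> in M. norm (A \<omega> * of_real (sgn (X \<omega>) *
          (Si ((1 + real n) * \<bar>X \<omega>\<bar>) - Si (1 / (1 + real n) * \<bar>X \<omega>\<bar>)))) \<le> 2 * B" for n
    proof (intro AE_I2)
      fix \<omega>
      have "norm (A \<omega> * of_real (sgn (X \<omega>) *
          (Si ((1 + real n) * \<bar>X \<omega>\<bar>) - Si (1 / (1 + real n) * \<bar>X \<omega>\<bar>))))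
        = norm (A \<omega>) * (\<bar>sgn (X \<omega>)\<bar> * \<bar>Si ((1 + real n) * \<bar>X \<omega>\<bar>) - Si (1 / (1 + real n) * \<bar>X \<omega>\<bar>)\<bar>)"
        by (simp only: norm_mult norm_of_real abs_mult)
      also have "\<dots> \<le> 1 * (1 * (2 * B))"
        using B[of "(1 + real n) * \<bar>X \<omega>\<bar>"] B[of "1 / (1 + real n) * \<bar>X \<omega>\<bar>"]
        by (intro mult_mono A) (auto simp: abs_sgn_eq)
      finally show "norm (A \<omega> * of_real (sgn (X \<omega>) *
          (Si ((1 + real n) * \<bar>X \<omega>\<bar>) - Si (1 / (1 + real n) * \<bar>X \<omega>\<bar>)))) \<le> 2 * B" by simp
    qed
  qed measurable
  also have "(LINT \<omega>|M. A \<omega> * of_real (sgn (X \<omega>) * (pi / 2)))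
      = (LINT \<omega>|M. of_real (pi / 2) * (A \<omega> * of_real (sgn (X \<omega>))))"
    by (intro Bochner_Integration.integral_cong) (auto simp: mult_ac)
  also have "\<dots> = of_real (pi / 2) * (LINT \<omega>|M. A \<omega> * of_real (sgn (X \<omega>)))"
    by (rule integral_mult_right_zero)
  finally show ?thesis unfolding swap .
qed

text \<open>By Euler's formula a sine factor in \<open>X a\<close> only shifts the frequency
  \<open>l a\<close> by \<open>t\<close> and by \<open>-t\<close>. A statement quantified over all
  \<open>l\<close> therefore survives the introduction of one more sign.\<close>

lemma integral_times_sin_char:
  fixes A :: "'a \<Rightarrow> complex" and X :: "'i \<Rightarrow> 'a \<Rightarrow> real"
  assumes "prob_space M" and [measurable]: "A \<in> borel_measurable M" "\<And>u. u \<in> U \<Longrightarrow> X u \<in> borel_measurable M"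
    and A: "\<And>\<omega>. norm (A \<omega>) \<le> 1" and U: "finite U" "a \<in> U"
  shows "(LINT \<omega>|M. (A \<omega> * iexp (\<Sum>u\<in>U. l u * X u \<omega>)) * of_real (sin (t * (X a \<omega> - c))))
    = (iexp (- t * c) * (LINT \<omega>|M. A \<omega> * iexp (\<Sum>u\<in>U. (l(a := l a + t)) u * X u \<omega>))
     - iexp (t * c) * (LINT \<omega>|M. A \<omega> * iexp (\<Sum>u\<in>U. (l(a := l a - t)) u * X u \<omega>))) / (2 * \<i>)"
proof -
  interpret prob_space M by fact
  have int: "integrable M (\<lambda>\<omega>. A \<omega> * iexp (\<Sum>u\<in>U. l u * X u \<omega>))" for l
    by (rule integrable_const_bound[where B=1]) (auto simp: norm_mult A)
  have upd: "(\<Sum>u\<in>U. (l(a := l a + r)) u * X u \<omega>) = (\<Sum>u\<in>U. l u * X u \<omega>) + r * X a \<omega>" for r \<omega>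
    using U by (simp add: sum.remove[of U a] algebra_simps)
  have shift: "A \<omega> * iexp (\<Sum>u\<in>U. (l(a := l a + r)) u * X u \<omega>)
      = (A \<omega> * iexp (\<Sum>u\<in>U. l u * X u \<omega>)) * iexp (r * X a \<omega>)" for r \<omega>
    unfolding upd by (simp only: of_real_add distrib_left exp_add mult.assoc)
  have sin: "complex_of_real (sin (t * (X a \<omega> - c)))
       = (iexp (- t * c) * iexp (t * X a \<omega>) - iexp (t * c) * iexp (- t * X a \<omega>)) / (2 * \<i>)" for \<omega>
    unfolding sin_of_real[symmetric] sin_exp_eq by (simp add: exp_add[symmetric] algebra_simps)
  have eq: "(A \<omega> * iexp (\<Sum>u\<in>U. l u * X u \<omega>)) * of_real (sin (t * (X a \<omega> - c)))
    = (iexp (- t * c) * (A \<omega> * iexp (\<Sum>u\<in>U. (l(a := l a + t)) u * X u \<omega>))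
     - iexp (t * c) * (A \<omega> * iexp (\<Sum>u\<in>U. (l(a := l a - t)) u * X u \<omega>))) / (2 * \<i>)" for \<omega>
    using shift[of \<omega> t] shift[of \<omega> "-t"] unfolding sin
    by (simp only: diff_conv_add_uminus[symmetric] right_diff_distrib times_divide_eq_right mult_ac)
  show ?thesis
    unfolding eq integral_divide_zero
    by (subst Bochner_Integration.integral_diff[OF integrable_mult_right[OF int] integrable_mult_right[OF int]])
      (simp only: integral_mult_right_zero)
qed

text \<open>The signs are introduced one at a time, writing \<open>sgn x\<close> as the bounded limit of
  \<open>2 / pi * \<integral> sin (t * x) / t dt\<close> over growing intervals, so that only characteristic functions occur.\<close>

proposition expectation_prod_sgn_eqI:
  fixes X :: "'i \<Rightarrow> 'a \<Rightarrow> real" and Y :: "'i \<Rightarrow> 'b \<Rightarrow> real"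
  assumes "prob_space M" "prob_space N" and U: "finite U"
    and [measurable]: "\<And>u. u \<in> U \<Longrightarrow> X u \<in> borel_measurable M" "\<And>u. u \<in> U \<Longrightarrow> Y u \<in> borel_measurable N"
    and char: "\<And>l :: 'i \<Rightarrow> real. (LINT \<omega>|M. iexp (\<Sum>u\<in>U. l u * X u \<omega>)) = (LINT \<omega>|N. iexp (\<Sum>u\<in>U. l u * Y u \<omega>))"
  shows "(LINT \<omega>|M. (\<Prod>u\<in>U. sgn (X u \<omega> - s u))) = (LINT \<omega>|N. (\<Prod>u\<in>U. sgn (Y u \<omega> - s u)))"
proof -
  interpret M: prob_space M by fact
  interpret N: prob_space N by fact
  have *: "norm (\<Prod>u\<in>A. complex_of_real (sgn (f u))) \<le> 1" for A and f :: "'i \<Rightarrow> real"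
    unfolding prod_norm[symmetric] by (intro prod_le_1) (auto simp: abs_sgn_eq)
  \<comment> \<open>The induction adds signs over a subset \<open>A\<close> only, while the
    exponential keeps all of \<open>U\<close> with arbitrary frequencies; taking
    \<open>l = 0\<close> at the end removes it.\<close>
  have "(LINT \<omega>|M. (\<Prod>u\<in>A. complex_of_real (sgn (X u \<omega> - s u))) * iexp (\<Sum>u\<in>U. l u * X u \<omega>))
      = (LINT \<omega>|N. (\<Prod>u\<in>A. complex_of_real (sgn (Y u \<omega> - s u))) * iexp (\<Sum>u\<in>U. l u * Y u \<omega>))"
    if "A \<subseteq> U" for A l
    using finite_subset[OF that U] that
  proof (induction A arbitrary: l)
    case empty
    then show ?case using char by simp
  next
    case (insert a A)
    then have a: "a \<in> U" "A \<subseteq> U" by auto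
    have sgn_meas: "(\<lambda>x::real. complex_of_real (sgn (x - c))) \<in> borel_measurable borel" for c
      by measurable
    have [measurable]: "(\<lambda>\<omega>. \<Prod>u\<in>A. complex_of_real (sgn (X u \<omega> - s u))) \<in> borel_measurable M"
      by (rule borel_measurable_prod, rule measurable_compose[OF _ sgn_meas]) (use a in auto)
    have [measurable]: "(\<lambda>\<omega>. \<Prod>u\<in>A. complex_of_real (sgn (Y u \<omega> - s u))) \<in> borel_measurable N"
      by (rule borel_measurable_prod, rule measurable_compose[OF _ sgn_meas]) (use a in auto)
    have [measurable]: "X a \<in> borel_measurable M" "Y a \<in> borel_measurable N" using a by auto
    let ?A = "\<lambda>\<omega>. (\<Prod>u\<in>A. complex_of_real (sgn (X u \<omega> - s u))) * iexp (\<Sum>u\<in>U. l u * X u \<omega>)"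
    let ?B = "\<lambda>\<omega>. (\<Prod>u\<in>A. complex_of_real (sgn (Y u \<omega> - s u))) * iexp (\<Sum>u\<in>U. l u * Y u \<omega>)"
    have "(LINT \<omega>|M. ?A \<omega> * of_real (sin (t * (X a \<omega> - s a))))
       = (LINT \<omega>|N. ?B \<omega> * of_real (sin (t * (Y a \<omega> - s a))))" for t
      using a U * assms(1,2)
      by (subst (1 2) integral_times_sin_char) (auto simp only: insert.IH[OF a(2)] assms(4,5), simp_all)
    then have "of_real (pi / 2) * (LINT \<omega>|M. ?A \<omega> * of_real (sgn (X a \<omega> - s a))) =
        of_real (pi / 2) * (LINT \<omega>|N. ?B \<omega> * of_real (sgn (Y a \<omega> - s a)))"
      using M.sgn_fourier_limit[of ?A "\<lambda>\<omega>. X a \<omega> - s a"] N.sgn_fourier_limit[of ?B "\<lambda>\<omega>. Y a \<omega> - s a"] *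
      by (auto simp: norm_mult dest: LIMSEQ_unique)
    then show ?case
      using insert.hyps by (simp add: mult_ac)
  qed
  from this[of U "\<lambda>_. 0"] show ?thesis
    by (simp flip: of_real_prod)
qed

section \<open>The power series in hyperbolic coordinates\<close>

text \<open>A centred Gaussian process with covariance \<open>1 / cosh (u - v)\<close>, described by
  its joint characteristic functions. Identities in law are then checked on quadratic forms, without
  joint densities.\<close>

locale sech_process = prob_space M for M :: "'w measure" +
  fixes G :: "real \<Rightarrow> 'w \<Rightarrow> real"
  assumes meas [measurable]: "\<And>u. G u \<in> borel_measurable M"
    and char_G: "\<And>U l. finite U \<Longrightarrow> (LINT \<omega>|M. iexp (\<Sum>u\<in>U. l u * G u \<omega>))
      = of_real (exp (- (\<Sum>u\<in>U. \<Sum>v\<in>U. l u * l v / cosh (u - v)) / 2))"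

lemma inverse_cosh_diff:
  "1 / (cosh u * cosh v * (1 - tanh u * tanh v)) = 1 / cosh (u - v :: real)"
proof -
  have "cosh u * cosh v * (1 - tanh u * tanh v) = cosh (u - v)"
    by (simp add: cosh_diff tanh_def right_diff_distrib)
  then show ?thesis by simp
qed

text \<open>The squares are those of the coefficients of the series in a linear combination of
  normalised values, so their sum is its variance. Expanding them gives geometric series with ratio
  \<open>tanh u * tanh v\<close>.\<close>

lemma tanh_powers_sums:
  fixes l :: "real \<Rightarrow> real"
  assumes "finite U"
  shows "(\<lambda>j. (\<Sum>u\<in>U. l u * (tanh u ^ j / cosh u))\<^sup>2) sums (\<Sum>u\<in>U. \<Sum>v\<in>U. l u * l v / cosh (u - v))"
proof -
  have "(\<lambda>j. l u * l v * ((tanh u * tanh v) ^ j / (cosh u * cosh v))) sums (l u * l v / cosh (u - v))" for u v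
  proof -
    have "\<bar>tanh u * tanh v\<bar> < 1 * 1"
      unfolding abs_mult by (intro mult_strict_mono') (use tanh_real_bounds in \<open>auto simp: abs_less_iff\<close>)
    then have "(\<lambda>j. (tanh u * tanh v) ^ j) sums (1 / (1 - tanh u * tanh v))"
      by (intro geometric_sums) simp
    then have "(\<lambda>j. l u * l v * ((tanh u * tanh v) ^ j / (cosh u * cosh v))) sums
        (l u * l v * ((1 / (1 - tanh u * tanh v)) / (cosh u * cosh v)))"
      by (intro sums_mult sums_divide)
    also have "(1 / (1 - tanh u * tanh v)) / (cosh u * cosh v) = 1 / cosh (u - v)"
      by (subst inverse_cosh_diff[symmetric]) (simp add: mult_ac)
    finally show ?thesis by simp
  qed
  then have "(\<lambda>j. \<Sum>u\<in>U. \<Sum>v\<in>U. l u * l v * ((tanh u * tanh v) ^ j / (cosh u * cosh v))) sums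
     (\<Sum>u\<in>U. \<Sum>v\<in>U. l u * l v / cosh (u - v))"
    by (intro sums_sum) auto
  also have "(\<lambda>j. \<Sum>u\<in>U. \<Sum>v\<in>U. l u * l v * ((tanh u * tanh v) ^ j / (cosh u * cosh v))) =
     (\<lambda>j. (\<Sum>u\<in>U. l u * (tanh u ^ j / cosh u))\<^sup>2)"
    by (intro ext) (auto simp: power2_eq_square sum_product power_mult_distrib field_simps intro!: sum.cong)
  finally show ?thesis .
qed

section \<open>Almost sure convergence and joint law of the random series\<close>

lemma distr_std_normal:
  assumes "distributed M lborel X (\<lambda>x. ennreal (std_normal_density x))"
  shows "distr M borel X = std_normal_distribution"
proof -
  have "distr M borel X = distr M lborel X"
    by (rule distr_cong) auto
  also have "\<dots> = std_normal_distribution"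
    using assms by (simp add: distributed_def)
  finally show ?thesis .
qed

text \<open>The first absolute moment of \<open>a k\<close> does not depend on \<open>k\<close>, so
  the expected sum of absolute values is a convergent geometric series; a finite expectation forces
  finiteness almost everywhere.\<close>

lemma (in prob_space) AE_summable_random_power_series:
  fixes a :: "nat \<Rightarrow> 'a \<Rightarrow> real"
  assumes a: "\<And>k. distributed M lborel (a k) (\<lambda>x. ennreal (std_normal_density x))"
    and t: "\<bar>t\<bar> < 1"
  shows "AE \<omega> in M. summable (\<lambda>k. a k \<omega> * t ^ k)"
proof -
  have [measurable]: "a k \<in> borel_measurable M" for k
    using a[of k] by (simp add: distributed_def)
  define c where "c = (LINT x|std_normal_distribution. \<bar>x\<bar>)"
  have c: "(\<integral>\<^sup>+ \<omega>. ennreal \<bar>a k \<omega>\<bar> \<partial>M) = ennreal c" for k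
  proof -
    have "(\<integral>\<^sup>+ \<omega>. ennreal \<bar>a k \<omega>\<bar> \<partial>M) = (\<integral>\<^sup>+ x. ennreal \<bar>x\<bar> \<partial>distr M borel (a k))"
      by (subst nn_integral_distr) auto
    also have "\<dots> = (\<integral>\<^sup>+ x. ennreal \<bar>x\<bar> \<partial>std_normal_distribution)"
      by (simp only: distr_std_normal[OF a])
    also have "\<dots> = ennreal c"
      unfolding c_def using integrable_std_normal_distribution_moment[of 1]
      by (intro nn_integral_eq_integral) auto
    finally show ?thesis .
  qed
  have c0: "0 \<le> c" unfolding c_def by (intro integral_nonneg_AE) auto
  have "(\<integral>\<^sup>+ \<omega>. (\<Sum>k. ennreal \<bar>a k \<omega> * t ^ k\<bar>) \<partial>M) = (\<Sum>k. \<integral>\<^sup>+ \<omega>. ennreal \<bar>a k \<omega> * t ^ k\<bar> \<partial>M)"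
    by (intro nn_integral_suminf) auto
  also have "\<dots> = (\<Sum>k. ennreal (c * \<bar>t\<bar> ^ k))"
  proof (rule suminf_cong)
    fix k
    have "(\<integral>\<^sup>+ \<omega>. ennreal \<bar>a k \<omega> * t ^ k\<bar> \<partial>M) = (\<integral>\<^sup>+ \<omega>. ennreal \<bar>a k \<omega>\<bar> * ennreal (\<bar>t\<bar> ^ k) \<partial>M)"
      by (intro nn_integral_cong) (simp add: abs_mult power_abs ennreal_mult)
    also have "\<dots> = ennreal c * ennreal (\<bar>t\<bar> ^ k)"
      by (subst nn_integral_multc) (auto simp: c)
    finally show "(\<integral>\<^sup>+ \<omega>. ennreal \<bar>a k \<omega> * t ^ k\<bar> \<partial>M) = ennreal (c * \<bar>t\<bar> ^ k)"
      by (simp add: ennreal_mult c0)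
  qed
  also have "\<dots> = ennreal (\<Sum>k. c * \<bar>t\<bar> ^ k)"
    using t c0 by (intro suminf_ennreal_eq summable_sums summable_mult summable_geometric) auto
  also have "\<dots> < \<infinity>" by simp
  finally have "AE \<omega> in M. (\<Sum>k. ennreal \<bar>a k \<omega> * t ^ k\<bar>) \<noteq> \<infinity>"
    by (intro nn_integral_PInf_AE) auto
  then show ?thesis
  proof eventually_elim
    case (elim \<omega>)
    then have "summable (\<lambda>k. \<bar>a k \<omega> * t ^ k\<bar>)"
      by (intro summable_suminf_not_top) auto
    then show ?case by (rule summable_rabs_cancel)
  qed
qed

lemma (in prob_space) char_gaussian_sum:
  fixes a :: "nat \<Rightarrow> 'a \<Rightarrow> real"
  assumes indep: "indep_vars (\<lambda>_. borel) a UNIV"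
    and a: "\<And>k. distributed M lborel (a k) (\<lambda>x. ennreal (std_normal_density x))"
  shows "(LINT \<omega>|M. iexp (\<Sum>j<N. w j * a j \<omega>)) = of_real (exp (- (\<Sum>j<N. (w j)\<^sup>2) / 2))"
proof -
  have [measurable]: "a k \<in> borel_measurable M" for k
    using a[of k] by (simp add: distributed_def)
  have ind: "indep_vars (\<lambda>_. borel) (\<lambda>j. (\<lambda>x. w j * x) \<circ> a j) {..<N}"
    by (rule indep_vars_compose[OF indep_vars_subset[OF indep]]) auto
  have char: "char (distr M borel ((\<lambda>x. w j * x) \<circ> a j)) 1 = of_real (exp (- ((w j)\<^sup>2) / 2))" for j
  proof -
    have "char (distr M borel ((\<lambda>x. w j * x) \<circ> a j)) 1 = char (distr M borel (a j)) (w j)"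
      unfolding char_def by (subst (1 2) integral_distr) (auto simp: o_def)
    then show ?thesis
      by (simp add: distr_std_normal[OF a] char_std_normal_distribution)
  qed
  have "(LINT \<omega>|M. iexp (\<Sum>j<N. w j * a j \<omega>)) = char (distr M borel (\<lambda>\<omega>. \<Sum>j<N. ((\<lambda>x. w j * x) \<circ> a j) \<omega>)) 1"
    unfolding char_def by (subst integral_distr) (auto simp: o_def)
  also have "\<dots> = (\<Prod>j<N. char (distr M borel ((\<lambda>x. w j * x) \<circ> a j)) 1)"
    by (rule char_distr_sum[OF ind])
  also have "\<dots> = of_real (exp (- (\<Sum>j<N. (w j)\<^sup>2) / 2))"
    unfolding char by (simp add: exp_sum[symmetric] sum_negf sum_divide_distrib flip: of_real_prod)
  finally show ?thesis .
qed

text \<open>For finitely many points all series converge off one null set, so the explicit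
  characteristic functions of the partial sums pass to the limit by dominated convergence. The value
  of \<open>suminf\<close> on the null set does not affect the integrals.\<close>

proposition sech_process_power_series:
  fixes M :: "'w measure" and a :: "nat \<Rightarrow> 'w \<Rightarrow> real"
  assumes "prob_space M"
    and indep: "prob_space.indep_vars M (\<lambda>_. borel) a UNIV"
    and a: "\<And>k. distributed M lborel (a k) (\<lambda>x. ennreal (std_normal_density x))"
  shows "sech_process M (\<lambda>u \<omega>. random_power_series a \<omega> (tanh u) / cosh u)"
proof -
  interpret prob_space M by fact
  have [measurable]: "a k \<in> borel_measurable M" for k
    using a[of k] by (simp add: distributed_def)
  show ?thesis
  proof
    show "(\<lambda>\<omega>. random_power_series a \<omega> (tanh u) / cosh u) \<in> borel_measurable M" for u
      unfolding random_power_series_def by measurable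
    fix U :: "real set" and l :: "real \<Rightarrow> real"
    assume U: "finite U"
    define w where "w j = (\<Sum>u\<in>U. l u * (tanh u ^ j / cosh u))" for j
    let ?X = "\<lambda>\<omega>. \<Sum>u\<in>U. l u * (random_power_series a \<omega> (tanh u) / cosh u)"
    have "AE \<omega> in M. \<forall>u\<in>U. summable (\<lambda>k. a k \<omega> * tanh u ^ k)"
      using U by (subst AE_finite_all)
        (auto intro!: AE_summable_random_power_series[OF a] simp: abs_less_iff tanh_real_bounds minus_less_iff
           tanh_real_gt_neg1 tanh_real_lt_1)
    then have conv: "AE \<omega> in M. (\<lambda>N. \<Sum>j<N. w j * a j \<omega>) \<longlonglongrightarrow> ?X \<omega>"
    proof eventually_elim
      case (elim \<omega>)
      have "(\<lambda>j. \<Sum>u\<in>U. l u * (a j \<omega> * tanh u ^ j / cosh u)) sums ?X \<omega>"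
        unfolding random_power_series_def
        by (intro sums_sum sums_mult sums_divide summable_sums) (use elim in auto)
      also have "(\<lambda>j. \<Sum>u\<in>U. l u * (a j \<omega> * tanh u ^ j / cosh u)) = (\<lambda>j. w j * a j \<omega>)"
        unfolding w_def sum_distrib_right by (auto intro!: ext sum.cong)
      finally show ?case unfolding sums_def .
    qed
    have "(\<lambda>N. LINT \<omega>|M. iexp (\<Sum>j<N. w j * a j \<omega>)) \<longlonglongrightarrow> (LINT \<omega>|M. iexp (?X \<omega>))"
    proof (rule integral_dominated_convergence[where w="\<lambda>_. 1"])
      show "AE \<omega> in M. (\<lambda>N. iexp (\<Sum>j<N. w j * a j \<omega>)) \<longlonglongrightarrow> iexp (?X \<omega>)"
        using conv by eventually_elim (intro tendsto_intros)
      show "(\<lambda>\<omega>. iexp (?X \<omega>)) \<in> borel_measurable M"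
        unfolding random_power_series_def by measurable
    qed (auto simp del: of_real_sum)
    moreover have "(\<lambda>N. LINT \<omega>|M. iexp (\<Sum>j<N. w j * a j \<omega>)) \<longlonglongrightarrow>
       of_real (exp (- (\<Sum>u\<in>U. \<Sum>v\<in>U. l u * l v / cosh (u - v)) / 2))"
      unfolding char_gaussian_sum[OF indep a]
      using tanh_powers_sums[OF U, of l] unfolding sums_def w_def[symmetric]
      by (intro tendsto_intros) auto
    ultimately show "(LINT \<omega>|M. iexp (?X \<omega>))
       = of_real (exp (- (\<Sum>u\<in>U. \<Sum>v\<in>U. l u * l v / cosh (u - v)) / 2))"
      by (rule LIMSEQ_unique)
  qed
qed

section \<open>Differentiation lemmas\<close>

text \<open>Moving the jump of height 2 from \<open>a\<close> to \<open>z\<close> changes the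
  integral by -2 times the integral of \<open>h\<close> over the interval between them, which the
  fundamental theorem of calculus differentiates.\<close>

lemma sgn_integral_has_derivative:
  fixes h :: "real \<Rightarrow> real"
  assumes cont: "continuous_on UNIV h" and int: "integrable lborel h"
  shows "((\<lambda>y. LINT x|lborel. sgn (x - y) * h x) has_real_derivative (- 2 * h y)) (at y)"
proof -
  define a b where "a = y - 1" and "b = y + 1"
  have [measurable]: "h \<in> borel_measurable borel" using int by auto
  have ints: "integrable lborel (\<lambda>x. sgn (x - z) * h x)" for z
    by (rule Bochner_Integration.integrable_bound[OF int]) (auto simp: abs_mult abs_sgn_eq)
  have eq: "(LINT x|lborel. sgn (x - z) * h x) = (LINT x|lborel. sgn (x - a) * h x) - 2 * integral {a..z} h"
    if z: "z \<in> {a..b}" for z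
  proof -
    have "(LINT x|lborel. sgn (x - z) * h x) - (LINT x|lborel. sgn (x - a) * h x)
        = (LINT x|lborel. sgn (x - z) * h x - sgn (x - a) * h x)"
      by (rule Bochner_Integration.integral_diff[symmetric]) (rule ints)+
    also have "\<dots> = (LINT x|lborel. - 2 * (indicator {a..z} x * h x))"
    proof (rule integral_cong_AE)
      show "AE x in lborel. sgn (x - z) * h x - sgn (x - a) * h x = - 2 * (indicator {a..z} x * h x)"
        \<comment> \<open>At the endpoints \<open>sgn\<close> takes the value 0 and the pointwise
          identity may fail; two points are a null set.\<close>
        using AE_lborel_singleton[of a] AE_lborel_singleton[of z]
      proof eventually_elim
        case (elim x)
        then show ?case using z by (cases "x < a"; cases "x < z") auto
      qed
    qed measurable
    also have "\<dots> = - 2 * integral {a..z} h"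
    proof -
      have "set_integrable lborel {a..z} h"
        unfolding set_integrable_def
        by (rule Bochner_Integration.integrable_bound[OF int]) (auto split: split_indicator)
      from set_borel_integral_eq_integral(2)[OF this] show ?thesis
        by (simp add: set_lebesgue_integral_def)
    qed
    finally show ?thesis by simp
  qed
  have "((\<lambda>z. integral {a..z} h) has_real_derivative h y) (at y within {a..b})"
    by (rule integral_has_real_derivative) (auto simp: a_def b_def intro: continuous_on_subset[OF cont])
  then have "((\<lambda>z. (LINT x|lborel. sgn (x - a) * h x) - 2 * integral {a..z} h) has_real_derivative 0 - 2 * h y) (at y within {a..b})"
    by (intro derivative_intros DERIV_cmult)
  then have "((\<lambda>z. (LINT x|lborel. sgn (x - a) * h x) - 2 * integral {a..z} h) has_real_derivative - 2 * h y) (at y within {a..b})"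
    by simp
  then have "((\<lambda>z. LINT x|lborel. sgn (x - z) * h x) has_real_derivative - 2 * h y) (at y within {a..b})"
    by (rule has_field_derivative_transform_within[where d=1])
       (simp, simp add: a_def b_def, rule eq[symmetric])
  moreover have "at y within {a..b} = at y"
    by (intro at_within_interior) (auto simp: a_def b_def)
  ultimately show ?thesis by simp
qed

text \<open>The function \<open>I y = \<integral> sgn (x - y) F' x dx\<close> has derivative \<open>-2 F' y\<close>, so \<open>I + 2 F\<close> is constant;
  its limits at \<open>\<plusminus>\<infinity>\<close> are \<open>\<minusplus>\<integral> F'\<close>, so the constant is \<open>0\<close>.\<close>

lemma integral_sgn_derivative:
  fixes F f :: "real \<Rightarrow> real"
  assumes deriv: "\<And>x. (F has_real_derivative f x) (at x)"
    and cont: "continuous_on UNIV f" and int: "integrable lborel f"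
    and lim: "(F \<longlongrightarrow> 0) at_top" "(F \<longlongrightarrow> 0) at_bot"
  shows "(LINT x|lborel. sgn x * f x) = - 2 * F 0"
proof -
  define I where "I y = (LINT x|lborel. sgn (x - y) * f x)" for y
  have [measurable]: "f \<in> borel_measurable borel" using int by auto
  have "((\<lambda>y. I y + 2 * F y) has_real_derivative 0) (at x within UNIV)" for x
    using DERIV_add[OF sgn_integral_has_derivative[OF cont int, of x] DERIV_cmult[OF deriv, of 2 x]]
    by (simp add: I_def)
  then obtain c where c: "\<And>x. I x + 2 * F x = c"
    using has_field_derivative_zero_constant[of UNIV "\<lambda>y. I y + 2 * F y"] by auto
  have 1: "(I \<longlongrightarrow> (LINT x|lborel. - f x)) at_top" unfolding I_def
  proof (rule integral_dominated_convergence_at_top[where w="\<lambda>x. norm (f x)"])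
    show "AE x in lborel. ((\<lambda>y. sgn (x - y) * f x) \<longlongrightarrow> - f x) at_top"
    proof (intro AE_I2 tendsto_eventually)
      fix x show "\<forall>\<^sub>F y in at_top. sgn (x - y) * f x = - f x"
        by (rule eventually_mono[OF eventually_gt_at_top[of x]]) auto
    qed
  qed (use int in \<open>auto simp: abs_mult abs_sgn_eq\<close>)
  have 2: "((\<lambda>y. I (- y)) \<longlongrightarrow> (LINT x|lborel. f x)) at_top" unfolding I_def
  proof (rule integral_dominated_convergence_at_top[where w="\<lambda>x. norm (f x)"])
    show "AE x in lborel. ((\<lambda>y. sgn (x - - y) * f x) \<longlongrightarrow> f x) at_top"
    proof (intro AE_I2 tendsto_eventually)
      fix x show "\<forall>\<^sub>F y in at_top. sgn (x - - y) * f x = f x"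
        by (rule eventually_mono[OF eventually_gt_at_top[of "-x"]]) auto
    qed
  qed (use int in \<open>auto simp: abs_mult abs_sgn_eq\<close>)
  have "((\<lambda>x. I x + 2 * F x) \<longlongrightarrow> (LINT x|lborel. - f x) + 2 * 0) at_top"
    by (intro tendsto_intros 1 lim)
  then have "c = - (LINT x|lborel. f x)"
    unfolding c by (simp add: tendsto_const_iff)
  moreover have "((\<lambda>x. F (- x)) \<longlongrightarrow> 0) at_top"
    using lim(2) by (simp add: filterlim_at_bot_mirror)
  then have "((\<lambda>x. I (- x) + 2 * F (- x)) \<longlongrightarrow> (LINT x|lborel. f x) + 2 * 0) at_top"
    by (intro tendsto_intros 2)
  then have "c = (LINT x|lborel. f x)"
    unfolding c by (simp add: tendsto_const_iff)
  ultimately show ?thesis using c[of 0] by (simp add: I_def)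
qed

text \<open>A chain rule for finitely many coordinates. \<open>Q\<close> acts on functions on an
  index type, which carry no norm here, so the coordinates are switched from \<open>s v0\<close> to
  \<open>s v\<close> one at a time, and continuity of the partial derivatives is asked for along
  curves.\<close>

lemma has_derivative_along_curve:
  fixes Q :: "('i \<Rightarrow> real) \<Rightarrow> real" and s :: "real \<Rightarrow> 'i \<Rightarrow> real"
  assumes U: "finite U"
    and dep: "\<And>r r'. (\<And>k. k \<in> U \<Longrightarrow> r k = r' k) \<Longrightarrow> Q r = Q r'"
    and partial: "\<And>j r y. j \<in> U \<Longrightarrow> ((\<lambda>y. Q (r(j := y))) has_real_derivative D j (r(j := y))) (at y)"
    and cont: "\<And>j r. j \<in> U \<Longrightarrow> (\<And>k. k \<in> U \<Longrightarrow> isCont (\<lambda>v. r v k) v0) \<Longrightarrow> isCont (\<lambda>v. D j (r v)) v0"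
    and s: "\<And>k. k \<in> U \<Longrightarrow> ((\<lambda>v. s v k) has_real_derivative s' k) (at v0)"
  shows "((\<lambda>v. Q (s v)) has_real_derivative (\<Sum>j\<in>U. D j (s v0) * s' j)) (at v0)"
proof -
  have "((\<lambda>v. Q (\<lambda>k. if k \<in> A then s v k else s v0 k)) has_real_derivative (\<Sum>j\<in>A. D j (s v0) * s' j)) (at v0)"
    if "A \<subseteq> U" for A
    using finite_subset[OF that U] that
  proof (induction A)
    case empty
    then show ?case by simp
  next
    case (insert a A)
    then have a: "a \<in> U" by simp
    define R where "R v = (\<lambda>k. if k \<in> A then s v k else s v0 k)" for v
    have R0: "R v0 = s v0" by (auto simp: R_def)
    define E where "E v = Q ((R v)(a := s v a)) - Q ((R v)(a := s v0 a))" for v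
    have eq: "Q (\<lambda>k. if k \<in> insert a A then s v k else s v0 k) = Q (R v) + E v" for v
    proof -
      have "(\<lambda>k. if k \<in> insert a A then s v k else s v0 k) = (R v)(a := s v a)"
        by (auto simp: R_def)
      moreover have "R v = (R v)(a := s v0 a)" using insert.hyps by (auto simp: R_def)
      ultimately show ?thesis unfolding E_def by simp
    qed
    \<comment> \<open>Mean value theorem in the coordinate \<open>a\<close> alone; the intermediate
      point is squeezed to \<open>s v0 a\<close> as \<open>v\<close> tends to
      \<open>v0\<close>.\<close>
    have "\<exists>\<xi>. \<bar>\<xi> - s v0 a\<bar> \<le> \<bar>s v a - s v0 a\<bar> \<and> E v = D a ((R v)(a := \<xi>)) * (s v a - s v0 a)" for v
    proof -
      have d: "((\<lambda>y. Q ((R v)(a := y))) has_real_derivative D a ((R v)(a := y))) (at y)" for y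
        by (rule partial[OF a])
      consider "s v a = s v0 a" | "s v0 a < s v a" | "s v a < s v0 a" by linarith
      then show ?thesis
      proof cases
        case 1
        then show ?thesis by (intro exI[of _ "s v0 a"]) (simp add: E_def)
      next
        case 2
        from MVT2[OF this d] obtain z where "s v0 a < z" "z < s v a"
          "Q ((R v)(a := s v a)) - Q ((R v)(a := s v0 a)) = (s v a - s v0 a) * D a ((R v)(a := z))"
          by blast
        then show ?thesis by (intro exI[of _ z]) (auto simp: E_def mult.commute)
      next
        case 3
        from MVT2[OF this d] obtain z where "s v a < z" "z < s v0 a"
          "Q ((R v)(a := s v0 a)) - Q ((R v)(a := s v a)) = (s v0 a - s v a) * D a ((R v)(a := z))"
          by blast
        then show ?thesis by (intro exI[of _ z]) (auto simp: E_def algebra_simps)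
      qed
    qed
    then obtain \<xi> where \<xi>: "\<And>v. \<bar>\<xi> v - s v0 a\<bar> \<le> \<bar>s v a - s v0 a\<bar>"
        "\<And>v. E v = D a ((R v)(a := \<xi> v)) * (s v a - s v0 a)"
      by metis
    have sc: "isCont (\<lambda>v. s v k) v0" if "k \<in> U" for k
      using s[OF that] by (rule DERIV_isCont)
    have "((\<lambda>v. \<bar>s v a - s v0 a\<bar>) \<longlongrightarrow> 0) (at v0)"
      using sc[OF a] unfolding isCont_def by (intro tendsto_rabs_zero) (simp add: LIM_zero)
    then have "((\<lambda>v. \<xi> v - s v0 a) \<longlongrightarrow> 0) (at v0)"
      by (rule Lim_null_comparison[rotated]) (auto simp: \<xi>(1))
    moreover have \<xi>0: "\<xi> v0 = s v0 a" using \<xi>(1)[of v0] by simp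
    ultimately have \<xi>c: "isCont \<xi> v0" unfolding isCont_def by (simp add: LIM_zero_iff)
    \<comment> \<open>The intermediate points themselves form a curve continuous at
      \<open>v0\<close>, to which the continuity assumption on the partial derivatives
      applies.\<close>
    have "isCont (\<lambda>v. D a ((R v)(a := \<xi> v))) v0"
    proof (rule cont[OF a])
      fix k assume "k \<in> U"
      then show "isCont (\<lambda>v. ((R v)(a := \<xi> v)) k) v0"
        using \<xi>c sc by (cases "k = a"; cases "k \<in> A") (auto simp: R_def)
    qed
    then have "((\<lambda>v. D a ((R v)(a := \<xi> v))) \<longlongrightarrow> D a (s v0)) (at v0)"
      unfolding isCont_def by (simp add: \<xi>0 R0)
    moreover have "((\<lambda>v. (s v a - s v0 a) / (v - v0)) \<longlongrightarrow> s' a) (at v0)"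
      using s[OF a] by (simp add: has_field_derivative_iff)
    ultimately have "((\<lambda>v. D a ((R v)(a := \<xi> v)) * ((s v a - s v0 a) / (v - v0))) \<longlongrightarrow> D a (s v0) * s' a) (at v0)"
      by (intro tendsto_mult)
    then have "(E has_real_derivative D a (s v0) * s' a) (at v0)"
      unfolding has_field_derivative_iff by (simp add: \<xi>(2))
    then have "((\<lambda>v. Q (R v) + E v) has_real_derivative (\<Sum>j\<in>A. D j (s v0) * s' j) + D a (s v0) * s' a) (at v0)"
      using insert.IH insert.prems unfolding R_def by (intro DERIV_add) auto
    then show ?case
      unfolding eq using insert.hyps by (simp add: add.commute)
  qed
  moreover have "Q (s v) = Q (\<lambda>k. if k \<in> U then s v k else s v0 k)" for v
    by (rule dep) auto
  ultimately show ?thesis by simp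
qed

text \<open>The mean value inequality bounds the difference quotients by \<open>w\<close>.
  Domination is local, since in the application the bounds degenerate as \<open>v\<close> approaches
  one of the other points.\<close>

lemma has_derivative_under_integral:
  fixes f f' :: "real \<Rightarrow> real \<Rightarrow> real"
  assumes d: "0 < \<delta>"
    and deriv: "\<And>v x. \<bar>v - v0\<bar> < \<delta> \<Longrightarrow> ((\<lambda>v. f v x) has_real_derivative f' v x) (at v)"
    and int: "\<And>v. \<bar>v - v0\<bar> < \<delta> \<Longrightarrow> integrable N (f v)"
    and meas: "f' v0 \<in> borel_measurable N"
    and w: "integrable N w" and bound: "\<And>v x. \<bar>v - v0\<bar> < \<delta> \<Longrightarrow> \<bar>f' v x\<bar> \<le> w x"
  shows "((\<lambda>v. LINT x|N. f v x) has_real_derivative (LINT x|N. f' v0 x)) (at v0)"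
  unfolding has_field_derivative_iff tendsto_at_iff_sequentially
proof (intro allI impI)
  fix X :: "nat \<Rightarrow> real"
  assume X: "\<forall>i. X i \<in> UNIV - {v0}" "X \<longlonglongrightarrow> v0"
  have "eventually (\<lambda>n. \<bar>X n - v0\<bar> < \<delta>) sequentially"
    using tendstoD[OF X(2) d] by (simp add: dist_real_def)
  then obtain n0 where n0: "\<And>n. n \<ge> n0 \<Longrightarrow> \<bar>X n - v0\<bar> < \<delta>"
    by (auto simp: eventually_sequentially)
  let ?Y = "\<lambda>n. X (n + n0)"
  have Y: "\<bar>?Y n - v0\<bar> < \<delta>" "?Y n \<noteq> v0" for n using n0 X(1) by auto
  have "(\<lambda>n. LINT x|N. (f (?Y n) x - f v0 x) / (?Y n - v0)) \<longlonglongrightarrow> (LINT x|N. f' v0 x)"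
  proof (rule integral_dominated_convergence[OF meas _ w])
    show "(\<lambda>x. (f (?Y n) x - f v0 x) / (?Y n - v0)) \<in> borel_measurable N" for n
      using borel_measurable_integrable[OF int[OF Y(1)]] borel_measurable_integrable[OF int[of v0]] d by simp
    show "AE x in N. (\<lambda>n. (f (?Y n) x - f v0 x) / (?Y n - v0)) \<longlonglongrightarrow> f' v0 x"
    proof (intro AE_I2)
      fix x
      have "((\<lambda>v. (f v x - f v0 x) / (v - v0)) \<longlongrightarrow> f' v0 x) (at v0)"
        using deriv[of v0 x] d by (simp add: has_field_derivative_iff)
      then have "((\<lambda>v. (f v x - f v0 x) / (v - v0)) \<circ> ?Y) \<longlonglongrightarrow> f' v0 x"
        using Y(2) LIMSEQ_ignore_initial_segment[OF X(2), of n0]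
        unfolding tendsto_at_iff_sequentially by auto
      then show "(\<lambda>n. (f (?Y n) x - f v0 x) / (?Y n - v0)) \<longlonglongrightarrow> f' v0 x" by (simp add: o_def)
    qed
    show "AE x in N. norm ((f (?Y n) x - f v0 x) / (?Y n - v0)) \<le> w x" for n
    proof (intro AE_I2)
      fix x
      have "norm (f (?Y n) x - f v0 x) \<le> w x * norm (?Y n - v0)"
      proof (rule field_differentiable_bound[of "{v0-\<delta><..<v0+\<delta>}"])
        fix z assume "z \<in> {v0-\<delta><..<v0+\<delta>}"
        then have z: "\<bar>z - v0\<bar> < \<delta>" by auto
        show "((\<lambda>v. f v x) has_field_derivative f' z x) (at z within {v0-\<delta><..<v0+\<delta>})"
          using deriv[OF z] by (rule has_field_derivative_at_within)
        show "norm (f' z x) \<le> w x" using bound[OF z] by simp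
      qed (use Y(1)[of n] d in auto)
      then show "norm ((f (?Y n) x - f v0 x) / (?Y n - v0)) \<le> w x"
        using Y(2)[of n] by (simp add: field_simps)
    qed
  qed
  also have "(\<lambda>n. LINT x|N. (f (?Y n) x - f v0 x) / (?Y n - v0)) =
      (\<lambda>n. ((LINT x|N. f (?Y n) x) - (LINT x|N. f v0 x)) / (?Y n - v0))"
    using int[OF Y(1)] int[of v0] d by (simp add: Bochner_Integration.integral_diff)
  finally show "((\<lambda>y. ((LINT x|N. f y x) - (LINT x|N. f v0 x)) / (y - v0)) \<circ> X) \<longlonglongrightarrow> (LINT x|N. f' v0 x)"
    unfolding o_def by (rule LIMSEQ_offset)
qed

section \<open>Sign moments of the process\<close>

lemma abs_prod_sgn_le: "\<bar>\<Prod>k\<in>U. sgn (f k :: real)\<bar> \<le> 1"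
  unfolding abs_prod by (rule prod_le_1) (auto simp: abs_sgn_eq)

lemma sgn_tanh: "sgn (tanh x) = sgn (x :: real)"
  by (simp add: sgn_if)

text \<open>With \<open>a = u - w\<close> and \<open>b = v - w\<close> the first summand is the part
  of the covariance explained by the value at \<open>w\<close>, the second the conditional
  covariance. The latter is the original kernel multiplied by \<open>tanh a * tanh b\<close>, which
  is what makes conditioning reproduce the process.\<close>

lemma sech_kernel_split:
  fixes a b :: real
  shows "1 / (cosh a * cosh b) + tanh a * tanh b / cosh (a - b) = 1 / cosh (a - b)"
proof -
  have "cosh (a - b) / (cosh a * cosh b) = 1 - tanh a * tanh b"
    by (simp add: cosh_diff tanh_def diff_divide_distrib)
  then have "(1 / cosh (a - b)) * (cosh (a - b) / (cosh a * cosh b)) = (1 / cosh (a - b)) * (1 - tanh a * tanh b)"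
    by simp
  then show ?thesis by (simp add: right_diff_distrib)
qed

context sech_process
begin

text \<open>The thresholds \<open>s\<close> are indexed by the points themselves. Conditioning
  creates nonzero thresholds even where all were zero.\<close>

definition sgn_moment :: "real set \<Rightarrow> (real \<Rightarrow> real) \<Rightarrow> real" where
  "sgn_moment U s = (LINT \<omega>|M. (\<Prod>u\<in>U. sgn (G u \<omega> - s u)))"

text \<open>The sign of the product of \<open>tanh (k - w)\<close>, left over when the conditioned
  process is divided by these factors.\<close>

definition point_sign :: "real \<Rightarrow> real set \<Rightarrow> real" where
  "point_sign w U = (\<Prod>k\<in>U. sgn (k - w))"

lemma sgn_moment_cong: "(\<And>k. k \<in> U \<Longrightarrow> s k = s' k) \<Longrightarrow> sgn_moment U s = sgn_moment U s'"
  unfolding sgn_moment_def by simp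

lemma abs_sgn_moment_le: "\<bar>sgn_moment U s\<bar> \<le> 1"
proof -
  have "\<bar>sgn_moment U s\<bar> \<le> (LINT \<omega>|M. \<bar>\<Prod>u\<in>U. sgn (G u \<omega> - s u)\<bar>)"
    unfolding sgn_moment_def by (rule integral_abs_bound)
  also have "\<dots> \<le> (LINT \<omega>|M. 1)"
    by (rule integral_mono') (auto intro: abs_prod_sgn_le)
  finally show ?thesis by (simp add: prob_space)
qed

lemma distr_G: "distr M borel (G u) = std_normal_distribution"
proof (rule Levy_uniqueness)
  show "real_distribution (distr M borel (G u))"
    by (rule real_distribution_distr) simp
  show "char (distr M borel (G u)) = char std_normal_distribution"
  proof
    fix t
    have "char (distr M borel (G u)) t = (LINT \<omega>|M. iexp (\<Sum>u\<in>{u}. t * G u \<omega>))"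
      unfolding char_def by (subst integral_distr) auto
    also have "\<dots> = of_real (exp (- (t\<^sup>2) / 2))"
      by (subst char_G) (auto simp: power2_eq_square)
    finally show "char (distr M borel (G u)) t = char std_normal_distribution t"
      by (simp add: char_std_normal_distribution)
  qed
qed (rule real_dist_normal_dist)

lemma AE_G_neq: "AE \<omega> in M. G u \<omega> \<noteq> c"
proof -
  have "AE x in std_normal_distribution. x \<noteq> c"
    by (subst AE_density) (auto intro: eventually_mono[OF AE_lborel_singleton[of c]])
  then have "AE x in distr M borel (G u). x \<noteq> c" by (simp only: distr_G)
  then show ?thesis by (subst (asm) AE_distr_iff) auto
qed

text \<open>Each \<open>G k\<close> is standard normal and so has no atoms: almost surely no
  coordinate sits on its threshold, and \<open>sgn\<close> is continuous everywhere else.\<close>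

lemma sgn_moment_tendsto:
  assumes "finite U" and r: "\<And>k. k \<in> U \<Longrightarrow> (\<lambda>n. r n k) \<longlonglongrightarrow> s k"
  shows "(\<lambda>n. sgn_moment U (r n)) \<longlonglongrightarrow> sgn_moment U s"
  unfolding sgn_moment_def
proof (rule integral_dominated_convergence[where w="\<lambda>_. 1"])
  have "AE \<omega> in M. \<forall>k\<in>U. G k \<omega> \<noteq> s k"
    using assms(1) by (simp add: AE_finite_all AE_G_neq)
  then show "AE \<omega> in M. (\<lambda>n. \<Prod>u\<in>U. sgn (G u \<omega> - r n u)) \<longlonglongrightarrow> (\<Prod>u\<in>U. sgn (G u \<omega> - s u))"
    by eventually_elim (auto intro!: tendsto_prod tendsto_sgn tendsto_diff r)
qed (auto simp: abs_prod_sgn_le)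

lemma isCont_sgn_moment:
  fixes s :: "real \<Rightarrow> real \<Rightarrow> real"
  assumes "finite U" and "\<And>k. k \<in> U \<Longrightarrow> isCont (\<lambda>v. s v k) v0"
  shows "isCont (\<lambda>v. sgn_moment U (s v)) v0"
  using assms unfolding continuous_at_sequentially o_def by (auto intro!: sgn_moment_tendsto)

text \<open>Conditioning on \<open>G w\<close>: the process \<open>x / cosh (u - w) + tanh (u - w) * G u\<close>, with an
  independent standard Gaussian \<open>x\<close>, has the same covariance as \<open>G\<close>.\<close>

lemma sgn_moment_insert:
  assumes "finite U" "w \<notin> U"
  shows "sgn_moment (insert w U) s = point_sign w U * (LINT x|lborel. std_normal_density x * (sgn (x - s w) *
      sgn_moment U (\<lambda>k. (s k - x / cosh (k - w)) / tanh (k - w))))"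
proof -
  let ?S = std_normal_distribution
  interpret S: real_distribution ?S by (rule real_dist_normal_dist)
  interpret P: pair_prob_space ?S M ..
  let ?N = "?S \<Otimes>\<^sub>M M"
  \<comment> \<open>At \<open>u = w\<close> this is \<open>fst z\<close> itself, because
    \<open>cosh 0 = 1\<close> and \<open>tanh 0 = 0\<close>.\<close>
  let ?Y = "\<lambda>u z. fst z / cosh (u - w) + tanh (u - w) * G u (snd z)"
  have [measurable]: "G u \<in> borel_measurable M" for u by simp
  have "sgn_moment (insert w U) s = (LINT z|?N. (\<Prod>u\<in>insert w U. sgn (?Y u z - s u)))"
    unfolding sgn_moment_def
  proof (rule expectation_prod_sgn_eqI)
    show "prob_space M" "prob_space ?N" by unfold_locales
    show "finite (insert w U)" using assms by simp
    show "?Y u \<in> borel_measurable ?N" for u by measurable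
    fix l :: "real \<Rightarrow> real"
    let ?V = "insert w U"
    define \<alpha> where "\<alpha> = (\<Sum>u\<in>?V. l u / cosh (u - w))"
    define \<beta> where "\<beta> \<omega> = (\<Sum>u\<in>?V. (l u * tanh (u - w)) * G u \<omega>)" for \<omega>
    have [measurable]: "\<beta> \<in> borel_measurable M" unfolding \<beta>_def by measurable
    have split: "(\<Sum>u\<in>?V. l u * ?Y u z) = \<alpha> * fst z + \<beta> (snd z)" for z
      unfolding \<alpha>_def \<beta>_def sum_distrib_right sum.distrib[symmetric]
      by (intro sum.cong) (auto simp: algebra_simps)
    have "(LINT z|?N. iexp (\<Sum>u\<in>?V. l u * ?Y u z)) = (LINT z|?N. iexp (\<alpha> * fst z) * iexp (\<beta> (snd z)))"
      unfolding split by (simp add: distrib_left exp_add)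
    also have "\<dots> = (LINT x|?S. LINT \<omega>|M. iexp (\<alpha> * x) * iexp (\<beta> \<omega>))"
      by (subst P.integral_fst'[symmetric]) (auto intro!: P.integrable_const_bound[where B=1] simp: norm_mult)
    also have "\<dots> = char ?S \<alpha> * (LINT \<omega>|M. iexp (\<beta> \<omega>))"
      unfolding char_def by simp
    also have "\<dots> = of_real (exp (- (\<alpha>\<^sup>2) / 2) *
          exp (- (\<Sum>u\<in>?V. \<Sum>v\<in>?V. (l u * tanh (u - w)) * (l v * tanh (v - w)) / cosh (u - v)) / 2))"
      unfolding \<beta>_def using assms by (subst char_G) (auto simp: char_std_normal_distribution)
    also have "\<dots> = of_real (exp (- (\<Sum>u\<in>?V. \<Sum>v\<in>?V. l u * l v / cosh (u - v)) / 2))"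
    proof -
      have e: "l u * l v / cosh (u - v) = (l u / cosh (u - w)) * (l v / cosh (v - w)) +
          (l u * tanh (u - w)) * (l v * tanh (v - w)) / cosh (u - v)" for u v
      proof -
        have "l u * l v * (1 / cosh (u - v)) = l u * l v * (1 / (cosh (u - w) * cosh (v - w)) + tanh (u - w) * tanh (v - w) / cosh (u - v))"
          using sech_kernel_split[of "u - w" "v - w"] by simp
        then show ?thesis by (simp add: algebra_simps)
      qed
      have "(\<Sum>u\<in>?V. \<Sum>v\<in>?V. l u * l v / cosh (u - v)) = \<alpha>\<^sup>2 +
         (\<Sum>u\<in>?V. \<Sum>v\<in>?V. (l u * tanh (u - w)) * (l v * tanh (v - w)) / cosh (u - v))"
        unfolding e sum.distrib \<alpha>_def power2_eq_square sum_product ..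
      then show ?thesis by (simp add: exp_add[symmetric] add_divide_distrib)
    qed
    also have "\<dots> = (LINT \<omega>|M. iexp (\<Sum>u\<in>?V. l u * G u \<omega>))"
      using assms by (subst char_G) auto
    finally show "(LINT \<omega>|M. iexp (\<Sum>u\<in>?V. l u * G u \<omega>)) = (LINT z|?N. iexp (\<Sum>u\<in>?V. l u * ?Y u z))" ..
  qed simp_all
  also have "\<dots> = (LINT x|?S. LINT \<omega>|M. (\<Prod>u\<in>insert w U. sgn (?Y u (x, \<omega>) - s u)))"
    by (subst P.integral_fst'[symmetric])
      (auto intro!: P.integrable_const_bound[where B=1] abs_prod_sgn_le simp del: prod.insert)
  also have "\<dots> = (LINT x|?S. point_sign w U * (sgn (x - s w) * sgn_moment U (\<lambda>k. (s k - x / cosh (k - w)) / tanh (k - w))))"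
  proof (rule Bochner_Integration.integral_cong[OF refl])
    fix x
    \<comment> \<open>Dividing by \<open>tanh (u - w)\<close>, nonzero since \<open>w\<close> is not
      in \<open>U\<close>, restores the form of \<open>G u\<close> against a threshold and leaves
      the sign of \<open>u - w\<close> outside.\<close>
    have f: "sgn (x / cosh (u - w) + tanh (u - w) * G u \<omega> - s u) = sgn (u - w) * sgn (G u \<omega> - (s u - x / cosh (u - w)) / tanh (u - w))"
      if "u \<in> U" for u \<omega>
    proof -
      have "tanh (u - w) \<noteq> 0" using that assms by auto
      then have "tanh (u - w) * ((s u - x / cosh (u - w)) / tanh (u - w)) = s u - x / cosh (u - w)"
        by simp
      then have "x / cosh (u - w) + tanh (u - w) * G u \<omega> - s u = tanh (u - w) * (G u \<omega> - (s u - x / cosh (u - w)) / tanh (u - w))"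
        by (simp only: right_diff_distrib)
      then show ?thesis by (simp only: sgn_mult sgn_tanh)
    qed
    have "(LINT \<omega>|M. (\<Prod>u\<in>insert w U. sgn (?Y u (x, \<omega>) - s u))) = (LINT \<omega>|M. (sgn (x - s w) * point_sign w U) *
        (\<Prod>u\<in>U. sgn (G u \<omega> - (s u - x / cosh (u - w)) / tanh (u - w))))"
      using assms by (intro Bochner_Integration.integral_cong refl) (simp add: f prod.distrib point_sign_def)
    also have "\<dots> = (sgn (x - s w) * point_sign w U) * sgn_moment U (\<lambda>k. (s k - x / cosh (k - w)) / tanh (k - w))"
      unfolding sgn_moment_def by simp
    finally show "(LINT \<omega>|M. (\<Prod>u\<in>insert w U. sgn (?Y u (x, \<omega>) - s u))) =
       point_sign w U * (sgn (x - s w) * sgn_moment U (\<lambda>k. (s k - x / cosh (k - w)) / tanh (k - w)))" by simp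
  qed
  also have "\<dots> = point_sign w U * (LINT x|?S. (sgn (x - s w) * sgn_moment U (\<lambda>k. (s k - x / cosh (k - w)) / tanh (k - w))))"
    by simp
  also have "(LINT x|?S. (sgn (x - s w) * sgn_moment U (\<lambda>k. (s k - x / cosh (k - w)) / tanh (k - w)))) =
     (LINT x|lborel. std_normal_density x * (sgn (x - s w) * sgn_moment U (\<lambda>k. (s k - x / cosh (k - w)) / tanh (k - w))))"
  proof (subst integral_density)
    have "continuous_on UNIV (\<lambda>x. sgn_moment U (\<lambda>k. (s k - x / cosh (k - w)) / tanh (k - w)))"
      unfolding continuous_on_eq_continuous_at[OF open_UNIV]
      by (intro ballI isCont_sgn_moment assms continuous_intros) (use assms in auto)
    then have "(\<lambda>x. sgn_moment U (\<lambda>k. (s k - x / cosh (k - w)) / tanh (k - w))) \<in> borel_measurable borel"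
      by (rule borel_measurable_continuous_onI)
    then show "(\<lambda>x. sgn (x - s w) * sgn_moment U (\<lambda>k. (s k - x / cosh (k - w)) / tanh (k - w))) \<in> borel_measurable lborel"
      by measurable
  qed auto
  finally show ?thesis .
qed

text \<open>After conditioning on the value at \<open>j\<close>, the threshold \<open>y\<close>
  occurs only in the factor \<open>sgn (x - y)\<close>, so the derivative is -2 times the remaining
  integrand at \<open>x = y\<close>.\<close>

lemma sgn_moment_partial_derivative:
  assumes "finite U" "j \<in> U"
  shows "((\<lambda>y. sgn_moment U (s(j := y))) has_real_derivative
     - 2 * std_normal_density y * point_sign j (U - {j}) * sgn_moment (U - {j}) (\<lambda>k. (s k - y / cosh (k - j)) / tanh (k - j))) (at y)"
proof -
  let ?A = "U - {j}"
  define h where "h x = std_normal_density x * sgn_moment ?A (\<lambda>k. (s k - x / cosh (k - j)) / tanh (k - j))" for x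
  have cont: "continuous_on UNIV h"
    unfolding continuous_on_eq_continuous_at[OF open_UNIV] h_def normal_density_def
    by (intro ballI continuous_intros isCont_sgn_moment) (use assms in auto)
  have int: "integrable lborel h"
  proof (rule Bochner_Integration.integrable_bound[where f = std_normal_density])
    show "h \<in> borel_measurable lborel" using borel_measurable_continuous_onI[OF cont] by simp
    show "AE x in lborel. norm (h x) \<le> norm (std_normal_density x)"
      using mult_left_mono[OF abs_sgn_moment_le] by (intro AE_I2) (auto simp: h_def abs_mult intro: mult_left_le)
  qed simp
  have eq: "sgn_moment U (s(j := y)) = point_sign j ?A * (LINT x|lborel. sgn (x - y) * h x)" for y
  proof -
    have "sgn_moment U (s(j := y)) = sgn_moment (insert j ?A) (s(j := y))" using assms by (simp add: insert_absorb)
    also have "\<dots> = point_sign j ?A * (LINT x|lborel. std_normal_density x * (sgn (x - (s(j := y)) j) *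
      sgn_moment ?A (\<lambda>k. ((s(j := y)) k - x / cosh (k - j)) / tanh (k - j))))"
      using assms by (intro sgn_moment_insert) auto
    also have "\<dots> = point_sign j ?A * (LINT x|lborel. sgn (x - y) * h x)"
    proof -
      have "sgn_moment ?A (\<lambda>k. ((s(j := y)) k - x / cosh (k - j)) / tanh (k - j)) =
          sgn_moment ?A (\<lambda>k. (s k - x / cosh (k - j)) / tanh (k - j))" for x
        by (rule sgn_moment_cong) auto
      then show ?thesis by (simp add: h_def mult_ac)
    qed
    finally show ?thesis .
  qed
  have "((\<lambda>y. point_sign j ?A * (LINT x|lborel. sgn (x - y) * h x)) has_real_derivative point_sign j ?A * (- 2 * h y)) (at y)"
    by (intro DERIV_cmult sgn_integral_has_derivative cont int)
  then show ?thesis unfolding eq by (simp add: h_def mult_ac)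
qed

lemma sgn_moment_derivative_along_curve:
  assumes U: "finite U" and s: "\<And>k. k \<in> U \<Longrightarrow> ((\<lambda>v. s v k) has_real_derivative s' k) (at v0)"
  shows "((\<lambda>v. sgn_moment U (s v)) has_real_derivative (\<Sum>j\<in>U.
     - 2 * std_normal_density (s v0 j) * point_sign j (U - {j}) *
       sgn_moment (U - {j}) (\<lambda>k. (s v0 k - s v0 j / cosh (k - j)) / tanh (k - j)) * s' j)) (at v0)"
proof (rule has_derivative_along_curve[where D="\<lambda>j r. - 2 * std_normal_density (r j) * point_sign j (U - {j}) *
       sgn_moment (U - {j}) (\<lambda>k. (r k - r j / cosh (k - j)) / tanh (k - j))"])
  show "sgn_moment U r = sgn_moment U r'" if "\<And>k. k \<in> U \<Longrightarrow> r k = r' k" for r r'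
    using that by (rule sgn_moment_cong)
  show "((\<lambda>y. sgn_moment U (r(j := y))) has_real_derivative
       - 2 * std_normal_density ((r(j := y)) j) * point_sign j (U - {j}) *
       sgn_moment (U - {j}) (\<lambda>k. ((r(j := y)) k - (r(j := y)) j / cosh (k - j)) / tanh (k - j))) (at y)"
    if "j \<in> U" for j r y
  proof -
    have "sgn_moment (U - {j}) (\<lambda>k. ((r(j := y)) k - (r(j := y)) j / cosh (k - j)) / tanh (k - j)) =
      sgn_moment (U - {j}) (\<lambda>k. (r k - y / cosh (k - j)) / tanh (k - j))"
      by (rule sgn_moment_cong) auto
    then show ?thesis using sgn_moment_partial_derivative[OF U that, of r y] by simp
  qed
  show "isCont (\<lambda>v. - 2 * std_normal_density (r v j) * point_sign j (U - {j}) *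
       sgn_moment (U - {j}) (\<lambda>k. (r v k - r v j / cosh (k - j)) / tanh (k - j))) v0"
    if "j \<in> U" "\<And>k. k \<in> U \<Longrightarrow> isCont (\<lambda>v. r v k) v0" for j r
    unfolding normal_density_def
    by (intro continuous_intros isCont_sgn_moment) (use that U in auto)
qed (use U s in auto)

end

section \<open>Gaussian and hyperbolic identities for the differentiated integrals\<close>

lemma std_normal_density_0: "std_normal_density 0 = 1 / sqrt (2 * pi)"
  by (simp add: normal_density_def)

lemma std_normal_density_0_square: "(2 * std_normal_density 0)\<^sup>2 = 2 / pi"
  by (simp add: std_normal_density_0 power_divide power_mult_distrib real_sqrt_pow2)

lemma std_normal_density_le_1: "std_normal_density x \<le> 1"
proof -
  have "exp (- x\<^sup>2 / 2) \<le> 1" by simp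
  also have "1 \<le> sqrt (2 * pi)" using pi_gt3 by simp
  finally show ?thesis
    by (simp add: normal_density_def divide_le_eq)
qed

text \<open>Rotational invariance of the planar Gaussian: \<open>tanh b\<close> and
  \<open>1 / cosh b\<close> are the cosine and sine of an angle, so the point lies at distance
  \<open>\<bar>y\<bar>\<close> from the origin.\<close>

lemma std_normal_density_rotate:
  "std_normal_density (tanh b * y) * std_normal_density (y / cosh b) = std_normal_density 0 * std_normal_density y"
proof -
  have "(tanh b)\<^sup>2 + (1 / cosh b)\<^sup>2 = ((sinh b)\<^sup>2 + 1) / (cosh b)\<^sup>2"
    by (simp add: tanh_def power_divide add_divide_distrib)
  also have "\<dots> = 1" unfolding cosh_square_eq[symmetric] by simp
  finally have "(tanh b)\<^sup>2 + (1 / cosh b)\<^sup>2 = 1" .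
  moreover have "(tanh b * y)\<^sup>2 + (y / cosh b)\<^sup>2 = ((tanh b)\<^sup>2 + (1 / cosh b)\<^sup>2) * y\<^sup>2"
    by (simp add: power_mult_distrib power_divide distrib_right)
  ultimately have "(tanh b * y)\<^sup>2 + (y / cosh b)\<^sup>2 = y\<^sup>2" by simp
  then have "exp (- (tanh b * y)\<^sup>2 / 2) * exp (- (y / cosh b)\<^sup>2 / 2) = exp (- y\<^sup>2 / 2)"
    unfolding exp_add[symmetric] by (simp add: field_simps)
  then show ?thesis by (simp add: normal_density_def)
qed

text \<open>The substitution \<open>x = - tanh b * y\<close> turns \<open>x / sinh b\<close> into
  \<open>- y / cosh b\<close>, and the two densities merge into one. The Jacobian supplies the
  factor \<open>tanh b\<close>.\<close>

lemma std_normal_integral_rotate: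
  fixes g :: "real \<Rightarrow> real"
  assumes "0 < b"
  shows "(LINT x|lborel. std_normal_density x * (std_normal_density (x / sinh b) * g (- (x / tanh b))))
    = std_normal_density 0 * tanh b * (LINT y|lborel. std_normal_density y * g y)"
proof -
  have t: "tanh b > 0" using assms by simp
  have "(LINT x|lborel. std_normal_density x * (std_normal_density (x / sinh b) * g (- (x / tanh b)))) =
      tanh b * (LINT y|lborel. std_normal_density (- tanh b * y) * (std_normal_density (- tanh b * y / sinh b) * g y))"
    using t by (subst lborel_integral_real_affine[where c="- tanh b" and t=0]) auto
  also have "(LINT y|lborel. std_normal_density (- tanh b * y) * (std_normal_density (- tanh b * y / sinh b) * g y)) =
      (LINT y|lborel. std_normal_density 0 * (std_normal_density y * g y))"
  proof (rule Bochner_Integration.integral_cong[OF refl])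
    fix y
    have "- tanh b * y / sinh b = - (y / cosh b)"
      using assms by (simp add: tanh_def)
    moreover have "std_normal_density (- z) = std_normal_density z" for z
      by (simp add: normal_density_def)
    ultimately show "std_normal_density (- tanh b * y) * (std_normal_density (- tanh b * y / sinh b) * g y) = std_normal_density 0 * (std_normal_density y * g y)"
      using std_normal_density_rotate[of b y] assms by (simp add: mult.assoc[symmetric])
  qed
  finally show ?thesis by simp
qed

text \<open>Conditioning at \<open>j\<close> sends the thresholds \<open>- y / sinh (k - v)\<close>
  to the same family with parameter \<open>- (y / tanh (j - v))\<close>. Behind it is the addition
  formula for \<open>sinh ((j - v) + (k - j))\<close>.\<close>

lemma hyperbolic_wedge_identity:
  assumes "v < j" "v < k" "k \<noteq> (j::real)"
  shows "(- y / sinh (k - v) - - y / sinh (j - v) / cosh (k - j)) / tanh (k - j) = - (- (y / tanh (j - v))) / sinh (k - v)"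
proof -
  define a b c d where "a = sinh (k - v)" and "b = sinh (j - v)" and "c = cosh (k - j)" and "d = sinh (k - j)"
  have "sinh (k - v) = sinh ((j - v) + (k - j))" by simp
  then have a: "a - b * c = cosh (j - v) * d"
    unfolding a_def b_def c_def d_def sinh_add by simp
  have nz: "a \<noteq> 0" "b \<noteq> 0" "c \<noteq> 0" "d \<noteq> 0" using assms by (auto simp: a_def b_def c_def d_def)
  have "- y / a - - y / b / c = y * (a - b * c) / (a * b * c)"
  proof -
    have "y * a / (a * (b * c)) = y / (b * c)" "y * (b * c) / (a * (b * c)) = y / a"
      using nz by (simp_all add: mult.commute)
    then have "y * (a - b * c) / (a * (b * c)) = y / (b * c) - y / a"
      by (simp only: right_diff_distrib diff_divide_distrib)
    then show ?thesis by (simp add: mult.assoc)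
  qed
  then have "- y / a - - y / b / c = y * (cosh (j - v) * d) / (a * b * c)"
    unfolding a .
  moreover have "y * (cosh (j - v) * d) / (a * b * c) / (d / c) = y * cosh (j - v) / (a * b)"
    using nz by simp
  ultimately have "(- y / a - - y / b / c) / (d / c) = y * cosh (j - v) / (a * b)"
    by (simp only:)
  then show ?thesis by (simp add: tanh_def a_def b_def c_def d_def)
qed

lemma arcsin_sech_derivative:
  fixes j v :: real
  assumes "v < j"
  shows "((\<lambda>v. arcsin (1 / cosh (j - v))) has_real_derivative 1 / cosh (j - v)) (at v)"
proof -
  have s: "0 < sinh (j - v)" using assms by simp
  have "1 < cosh (j - v)" using assms cosh_real_strict_mono[of 0 "j - v"] by simp
  then have c: "1 / cosh (j - v) < 1" "-1 < 1 / cosh (j - v)"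
    by (auto intro: less_trans[of _ 0])
  have "1 - (1 / cosh (j - v))\<^sup>2 = (sinh (j - v) / cosh (j - v))\<^sup>2"
    by (simp add: power_divide sinh_square_eq diff_divide_distrib)
  then have r: "sqrt (1 - (1 / cosh (j - v))\<^sup>2) = sinh (j - v) / cosh (j - v)"
    using s by (simp add: real_sqrt_unique)
  have "((\<lambda>v. 1 / cosh (j - v)) has_real_derivative sinh (j - v) / (cosh (j - v))\<^sup>2) (at v)"
    by (auto intro!: derivative_eq_intros simp: power2_eq_square)
  from DERIV_chain2[OF DERIV_arcsin[OF c(2,1)] this] show ?thesis
    unfolding r using s by (simp add: power2_eq_square)
qed

lemma sum_antisymmetric_zero:
  fixes a :: "'i \<Rightarrow> 'i \<Rightarrow> real"
  assumes "finite U" and anti: "\<And>i j. i \<in> U \<Longrightarrow> j \<in> U \<Longrightarrow> i \<noteq> j \<Longrightarrow> a i j = - a j i"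
  shows "(\<Sum>j\<in>U. \<Sum>i\<in>U - {j}. a j i) = 0"
proof -
  let ?b = "\<lambda>j i. if i = j then 0 else a j i"
  have eq: "(\<Sum>j\<in>U. \<Sum>i\<in>U - {j}. a j i) = (\<Sum>j\<in>U. \<Sum>i\<in>U. ?b j i)"
    using assms(1) by (intro sum.cong refl sum.mono_neutral_cong_left) auto
  also have "\<dots> = (\<Sum>j\<in>U. \<Sum>i\<in>U. ?b i j)" by (rule sum.swap)
  also have "\<dots> = - (\<Sum>j\<in>U. \<Sum>i\<in>U. ?b j i)"
    unfolding sum_negf[symmetric]
  proof (intro sum.cong refl)
    fix i j assume "i \<in> U" "j \<in> U"
    then show "?b j i = - ?b i j" using anti[of j i] by auto
  qed
  finally show ?thesis using eq by simp
qed

context sech_process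
begin

text \<open>These are the thresholds produced by \<open>sgn_moment_insert\<close> when \<open>w = v\<close> and \<open>s = 0\<close>.\<close>

definition ray_moment :: "real \<Rightarrow> real set \<Rightarrow> real \<Rightarrow> real" where
  "ray_moment v U y = sgn_moment U (\<lambda>k. - y / sinh (k - v))"

text \<open>For \<open>v\<close> below \<open>U\<close> this is the moment of
  \<open>insert v U\<close> with zero thresholds, and \<open>y\<close> is the value of the process
  at \<open>v\<close>. In this form \<open>v\<close> is a real parameter that can be varied.\<close>

definition ray_integral :: "real \<Rightarrow> real set \<Rightarrow> real" where
  "ray_integral v U = (LINT y|lborel. std_normal_density y * (sgn y * ray_moment v U y))"

lemma point_sign_le: "\<bar>point_sign j U\<bar> \<le> 1"
  unfolding point_sign_def by (rule abs_prod_sgn_le)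

lemma abs_ray_moment_le: "\<bar>ray_moment v U y\<bar> \<le> 1"
  unfolding ray_moment_def by (rule abs_sgn_moment_le)

lemma sgn_moment_insert_zero:
  assumes "finite U" "\<And>k. k \<in> U \<Longrightarrow> v < k"
  shows "sgn_moment (insert v U) (\<lambda>_. 0) = ray_integral v U"
proof -
  have "point_sign v U = 1" unfolding point_sign_def using assms by (intro prod.neutral) auto
  moreover have "sgn_moment U (\<lambda>k. (0 - x / cosh (k - v)) / tanh (k - v)) = ray_moment v U x" for x
    unfolding ray_moment_def by (rule sgn_moment_cong) (auto simp: tanh_def)
  ultimately show ?thesis
    using assms by (subst sgn_moment_insert) (auto simp: ray_integral_def)
qed

lemma isCont_ray_moment:
  assumes "finite U" "\<And>k. k \<in> U \<Longrightarrow> v < k"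
  shows "isCont (ray_moment v U) y"
  unfolding ray_moment_def[abs_def] using assms by (intro isCont_sgn_moment continuous_intros) auto

lemma borel_measurable_ray_moment:
  assumes "finite U" "\<And>k. k \<in> U \<Longrightarrow> v < k"
  shows "ray_moment v U \<in> borel_measurable borel"
  using isCont_ray_moment[OF assms] by (intro borel_measurable_continuous_onI) (simp add: continuous_on_eq_continuous_at)

text \<open>Linear growth of \<open>g\<close> covers the weights that occur: \<open>sgn y\<close>,
  \<open>\<bar>y\<bar>\<close> and \<open>- y\<close>.\<close>

lemma integrable_ray_moment:
  assumes "finite U" "\<And>k. k \<in> U \<Longrightarrow> v < k" and [measurable]: "g \<in> borel_measurable borel"
    and "\<And>y. \<bar>g y\<bar> \<le> c * (1 + \<bar>y\<bar>)"
  shows "integrable lborel (\<lambda>y. std_normal_density y * (g y * ray_moment v U y))"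
proof (rule Bochner_Integration.integrable_bound)
  show "integrable lborel (\<lambda>y. c * (std_normal_density y * \<bar>y\<bar> ^ 0) + c * (std_normal_density y * \<bar>y\<bar> ^ 1))"
    by (intro Bochner_Integration.integrable_add integrable_mult_right integrable_std_normal_moment_abs)
  note [measurable] = borel_measurable_ray_moment[OF assms(1,2)]
  show "(\<lambda>y. std_normal_density y * (g y * ray_moment v U y)) \<in> borel_measurable lborel"
    by measurable
  have "\<bar>std_normal_density y * (g y * ray_moment v U y)\<bar> \<le> std_normal_density y * (c * (1 + \<bar>y\<bar>) * 1)" for y
    unfolding abs_mult using assms(4)[of y] abs_ray_moment_le[of v U y]
    by (intro mult_mono) auto
  then have "\<bar>std_normal_density y * (g y * ray_moment v U y)\<bar> \<le> c * (std_normal_density y * \<bar>y\<bar> ^ 0) + c * (std_normal_density y * \<bar>y\<bar> ^ 1)" for y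
    by (simp add: algebra_simps)
  then show "AE y in lborel. norm (std_normal_density y * (g y * ray_moment v U y)) \<le> norm (c * (std_normal_density y * \<bar>y\<bar> ^ 0) + c * (std_normal_density y * \<bar>y\<bar> ^ 1))"
    unfolding real_norm_def by (intro AE_I2) (rule order_trans[OF _ abs_ge_self])
qed

lemma ray_moment_partial:
  assumes "j \<in> U" "\<And>k. k \<in> U \<Longrightarrow> v < k"
  shows "sgn_moment (U - {j}) (\<lambda>k. (- y / sinh (k - v) - - y / sinh (j - v) / cosh (k - j)) / tanh (k - j))
    = ray_moment v (U - {j}) (- (y / tanh (j - v)))"
  unfolding ray_moment_def by (intro sgn_moment_cong hyperbolic_wedge_identity) (use assms in auto)

lemma ray_moment_derivative_arg:
  assumes U: "finite U" "\<And>k. k \<in> U \<Longrightarrow> v < k"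
  shows "(ray_moment v U has_real_derivative (\<Sum>j\<in>U. 2 * point_sign j (U - {j}) / sinh (j - v) *
     (std_normal_density (y / sinh (j - v)) * ray_moment v (U - {j}) (- (y / tanh (j - v)))))) (at y)"
proof -
  have "((\<lambda>y. sgn_moment U (\<lambda>k. - y / sinh (k - v))) has_real_derivative (\<Sum>j\<in>U.
     - 2 * std_normal_density (- y / sinh (j - v)) * point_sign j (U - {j}) *
       sgn_moment (U - {j}) (\<lambda>k. (- y / sinh (k - v) - - y / sinh (j - v) / cosh (k - j)) / tanh (k - j)) * (- 1 / sinh (j - v)))) (at y)"
    by (rule sgn_moment_derivative_along_curve[OF U(1)]) (use U(1) in \<open>auto intro!: derivative_eq_intros dest: U(2)\<close>)
  also have "(\<Sum>j\<in>U.
     - 2 * std_normal_density (- y / sinh (j - v)) * point_sign j (U - {j}) *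
       sgn_moment (U - {j}) (\<lambda>k. (- y / sinh (k - v) - - y / sinh (j - v) / cosh (k - j)) / tanh (k - j)) * (- 1 / sinh (j - v)))
    = (\<Sum>j\<in>U. 2 * point_sign j (U - {j}) / sinh (j - v) *
     (std_normal_density (y / sinh (j - v)) * ray_moment v (U - {j}) (- (y / tanh (j - v)))))"
    by (intro sum.cong refl, subst ray_moment_partial) (use U in \<open>auto simp: normal_density_def mult_ac\<close>)
  finally show ?thesis unfolding ray_moment_def[abs_def] .
qed

text \<open>The threshold at \<open>j\<close> moves with speed
  \<open>- y * cosh (j - v) / (sinh (j - v))\<^sup>2\<close>. Compared with the derivative in
  \<open>y\<close> there is an additional factor \<open>y\<close>, which the integration by parts
  later removes.\<close>

lemma ray_moment_derivative_base:
  assumes U: "finite U" "\<And>k. k \<in> U \<Longrightarrow> v < k"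
  shows "((\<lambda>v. ray_moment v U y) has_real_derivative (\<Sum>j\<in>U. 2 * point_sign j (U - {j}) / (sinh (j - v) * tanh (j - v)) *
     (std_normal_density (y / sinh (j - v)) * (y * ray_moment v (U - {j}) (- (y / tanh (j - v))))))) (at v)"
proof -
  have "((\<lambda>v. sgn_moment U (\<lambda>k. - y / sinh (k - v))) has_real_derivative (\<Sum>j\<in>U.
     - 2 * std_normal_density (- y / sinh (j - v)) * point_sign j (U - {j}) *
       sgn_moment (U - {j}) (\<lambda>k. (- y / sinh (k - v) - - y / sinh (j - v) / cosh (k - j)) / tanh (k - j)) *
      (- y * cosh (j - v) / (sinh (j - v))\<^sup>2))) (at v)"
    by (rule sgn_moment_derivative_along_curve[OF U(1)])
      (use U(1) in \<open>auto intro!: derivative_eq_intros simp: power2_eq_square dest: U(2)\<close>)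
  also have "(\<Sum>j\<in>U.
     - 2 * std_normal_density (- y / sinh (j - v)) * point_sign j (U - {j}) *
       sgn_moment (U - {j}) (\<lambda>k. (- y / sinh (k - v) - - y / sinh (j - v) / cosh (k - j)) / tanh (k - j)) *
      (- y * cosh (j - v) / (sinh (j - v))\<^sup>2))
    = (\<Sum>j\<in>U. 2 * point_sign j (U - {j}) / (sinh (j - v) * tanh (j - v)) *
     (std_normal_density (y / sinh (j - v)) * (y * ray_moment v (U - {j}) (- (y / tanh (j - v))))))"
    by (intro sum.cong refl, subst ray_moment_partial) (use U in \<open>auto simp: normal_density_def tanh_def power2_eq_square mult_ac\<close>)
  finally show ?thesis unfolding ray_moment_def[abs_def] .
qed

text \<open>Integration by parts against \<open>- y * std_normal_density y\<close>, the derivative of the density.\<close>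

lemma ray_moment_abs_integral:
  assumes U: "finite U" "\<And>k. k \<in> U \<Longrightarrow> v < k"
  shows "(LINT y|lborel. std_normal_density y * (\<bar>y\<bar> * ray_moment v U y)) = 2 * std_normal_density 0 * sgn_moment U (\<lambda>_. 0)
     - (\<Sum>j\<in>U. point_sign j (U - {j}) * (2 * std_normal_density 0 / cosh (j - v)) * ray_integral v (U - {j}))"
proof -
  define q' where "q' y = (\<Sum>j\<in>U. 2 * point_sign j (U - {j}) / sinh (j - v) *
     (std_normal_density (y / sinh (j - v)) * ray_moment v (U - {j}) (- (y / tanh (j - v)))))" for y
  \<comment> \<open>The derivative of \<open>std_normal_density y * ray_moment v U y\<close>;
    integrated against \<open>sgn\<close>, it leaves only the value of that product at 0.\<close>
  define f where "f y = std_normal_density y * (- y * ray_moment v U y) + std_normal_density y * q' y" for y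
  have fin: "finite (U - {j})" "\<And>k. k \<in> U - {j} \<Longrightarrow> v < k" for j using U by auto
  have nz: "sinh (j - v) \<noteq> 0" "tanh (j - v) \<noteq> 0" if "j \<in> U" for j using U(2)[OF that] by auto
  have contq': "isCont q' y" for y
    unfolding q'_def[abs_def] normal_density_def
    by (intro continuous_intros continuous_within_compose3[OF isCont_ray_moment[OF fin]]) (use nz in auto)
  have cont: "continuous_on UNIV f"
    unfolding continuous_on_eq_continuous_at[OF open_UNIV] f_def[abs_def] normal_density_def
    by (intro ballI continuous_intros contq' continuous_within_compose3[OF isCont_ray_moment[OF U]]) auto
  have deriv: "((\<lambda>y. std_normal_density y * ray_moment v U y) has_real_derivative f y) (at y)" for y
  proof -
    have "(std_normal_density has_real_derivative - y * std_normal_density y) (at y)"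
    proof -
      have "((\<lambda>y. exp (- y\<^sup>2 / 2)) has_real_derivative - y * exp (- y\<^sup>2 / 2)) (at y)"
        by (auto intro!: derivative_eq_intros)
      from DERIV_cmult[OF this, of "1 / sqrt (2 * pi)"] show ?thesis
        by (simp add: std_normal_density_def[abs_def] mult_ac)
    qed
    from DERIV_mult[OF this ray_moment_derivative_arg[OF U, of y]] show ?thesis
      by (simp add: f_def q'_def mult_ac add.commute)
  qed
  define g where "g j x = (std_normal_density (x / sinh (j - v)) * ray_moment v (U - {j}) (- (x / tanh (j - v))))" for j x
  have [measurable]: "ray_moment v (U - {j}) \<in> borel_measurable borel" for j
    by (rule borel_measurable_ray_moment[OF fin])
  have [measurable]: "g j \<in> borel_measurable borel" for j unfolding g_def by measurable
  have g_le: "\<bar>g j x\<bar> \<le> 1" for j x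
    unfolding g_def abs_mult using std_normal_density_le_1 by (intro mult_le_one abs_ray_moment_le) auto
  have int1: "integrable lborel (\<lambda>y. std_normal_density y * (h y * g j y))"
    if [measurable]: "h \<in> borel_measurable borel" and h: "\<And>y. \<bar>h y\<bar> \<le> 1" for j and h :: "real \<Rightarrow> real"
  proof (rule Bochner_Integration.integrable_bound[where f=std_normal_density])
    show "AE y in lborel. norm (std_normal_density y * (h y * g j y)) \<le> norm (std_normal_density y)"
      by (intro AE_I2) (auto simp: abs_mult intro!: mult_left_le mult_le_one h g_le)
  qed auto
  have q'_eq: "std_normal_density y * (h y * q' y) = (\<Sum>j\<in>U. 2 * point_sign j (U - {j}) / sinh (j - v) * (std_normal_density y * (h y * g j y)))"
    for y and h :: "real \<Rightarrow> real"
    unfolding q'_def g_def sum_distrib_left by (intro sum.cong) auto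
  have intq: "integrable lborel (\<lambda>y. std_normal_density y * (- y * ray_moment v U y))"
    by (rule integrable_ray_moment[OF U, where c=1]) auto
  have intq': "integrable lborel (\<lambda>y. std_normal_density y * (h y * q' y))"
    if "h \<in> borel_measurable borel" "\<And>y. \<bar>h y\<bar> \<le> 1" for h :: "real \<Rightarrow> real"
    unfolding q'_eq using that by (intro Bochner_Integration.integrable_sum integrable_mult_right int1) auto
  have int: "integrable lborel f"
    using Bochner_Integration.integrable_add[OF intq intq'[of "\<lambda>_. 1"]] by (simp add: f_def[abs_def])
  have lim: "((\<lambda>y. std_normal_density y * ray_moment v U y) \<longlongrightarrow> 0) F" if "(std_normal_density \<longlongrightarrow> 0) F" for F
    using that by (rule Lim_null_comparison[rotated])
      (auto simp: abs_mult intro!: always_eventually mult_left_le abs_ray_moment_le)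
  have "(LINT y|lborel. sgn y * f y) = - 2 * (std_normal_density 0 * ray_moment v U 0)"
  proof (rule integral_sgn_derivative[OF deriv cont int lim lim])
    show "(std_normal_density \<longlongrightarrow> 0) at_top" "(std_normal_density \<longlongrightarrow> 0) at_bot"
      unfolding normal_density_def[abs_def] by real_asymp+
  qed
  also have "(LINT y|lborel. sgn y * f y) = (LINT y|lborel. - (std_normal_density y * (\<bar>y\<bar> * ray_moment v U y)) + std_normal_density y * (sgn y * q' y))"
    by (intro Bochner_Integration.integral_cong) (auto simp: f_def algebra_simps abs_sgn)
  also have "\<dots> = - (LINT y|lborel. std_normal_density y * (\<bar>y\<bar> * ray_moment v U y)) + (LINT y|lborel. std_normal_density y * (sgn y * q' y))"
    using integrable_ray_moment[OF U, of "\<lambda>y. \<bar>y\<bar>" 1]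
    by (subst Bochner_Integration.integral_add) (auto intro!: intq' simp: abs_sgn_eq)
  also have "(LINT y|lborel. std_normal_density y * (sgn y * q' y)) =
      (\<Sum>j\<in>U. 2 * point_sign j (U - {j}) / sinh (j - v) * (LINT y|lborel. std_normal_density y * (sgn y * g j y)))"
    unfolding q'_eq by (subst Bochner_Integration.integral_sum[OF integrable_mult_right[OF int1]]) (auto simp: abs_sgn_eq)
  also have "\<dots> = - (\<Sum>j\<in>U. point_sign j (U - {j}) * (2 * std_normal_density 0 / cosh (j - v)) * ray_integral v (U - {j}))"
    unfolding sum_negf[symmetric]
  proof (rule sum.cong[OF refl])
    fix j assume j: "j \<in> U"
    have b: "0 < j - v" using U(2)[OF j] by simp
    \<comment> \<open>The argument \<open>- (y / tanh (j - v))\<close> has the opposite sign of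
      \<open>y\<close>; this reversal is the source of the minus sign before the sum.\<close>
    have "sgn y * g j y = std_normal_density (y / sinh (j - v)) * (- sgn (- (y / tanh (j - v))) * ray_moment v (U - {j}) (- (y / tanh (j - v))))" for y
      using b by (simp add: g_def sgn_divide sgn_tanh)
    then have "(LINT y|lborel. std_normal_density y * (sgn y * g j y)) =
       std_normal_density 0 * tanh (j - v) * (LINT y|lborel. std_normal_density y * (- sgn y * ray_moment v (U - {j}) y))"
      using std_normal_integral_rotate[OF b, of "\<lambda>y. - sgn y * ray_moment v (U - {j}) y"] by (simp only:)
    also have "\<dots> = - (std_normal_density 0 * tanh (j - v) * ray_integral v (U - {j}))"
      unfolding ray_integral_def by simp
    finally show "2 * point_sign j (U - {j}) / sinh (j - v) * (LINT y|lborel. std_normal_density y * (sgn y * g j y)) =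
       - (point_sign j (U - {j}) * (2 * std_normal_density 0 / cosh (j - v)) * ray_integral v (U - {j}))"
      using nz[OF j] by (simp add: tanh_def)
  qed
  finally show ?thesis by (simp add: ray_moment_def)
qed

text \<open>The double sum left over by the integration by parts is antisymmetric in the two points.\<close>

lemma ray_integral_derivative:
  assumes U: "finite U" "\<And>k. k \<in> U \<Longrightarrow> v < k"
  shows "((\<lambda>v. ray_integral v U) has_real_derivative
    (\<Sum>j\<in>U. 2 / pi * point_sign j (U - {j}) * sgn_moment (U - {j}) (\<lambda>_. 0) / cosh (j - v))) (at v)"
proof -
  \<comment> \<open>Half the distance to the nearest point: within this radius \<open>sinh\<close>
    and \<open>tanh\<close> of \<open>j - z\<close> stay above their values at
    \<open>\<delta>\<close>, which gives the uniform bound \<open>K\<close>.\<close>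
  define \<delta> where "\<delta> = (if U = {} then 1 else (Min U - v) / 2)"
  have d: "0 < \<delta>" using U by (auto simp: \<delta>_def)
  have far: "\<delta> \<le> k - z" if "k \<in> U" "\<bar>z - v\<bar> < \<delta>" for k z
  proof -
    have "Min U \<le> k" "U \<noteq> {}" using that U(1) by auto
    moreover from this have "2 * \<delta> = Min U - v" by (simp add: \<delta>_def)
    ultimately show ?thesis using that(2) by linarith
  qed
  have less: "z < k" if "k \<in> U" "\<bar>z - v\<bar> < \<delta>" for k z using far[OF that] d by simp
  define g where "g z j x = std_normal_density (x / sinh (j - z)) * (x * ray_moment z (U - {j}) (- (x / tanh (j - z))))" for z j x
  define f' where "f' z x = std_normal_density x * (sgn x *
     (\<Sum>j\<in>U. 2 * point_sign j (U - {j}) / (sinh (j - z) * tanh (j - z)) * g z j x))" for z x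
  define K where "K = 2 / (sinh \<delta> * tanh \<delta>)"
  have fin: "finite (U - {j})" "\<And>k. k \<in> U - {j} \<Longrightarrow> v < k" for j using U by auto
  have [measurable]: "ray_moment v (U - {j}) \<in> borel_measurable borel" for j
    by (rule borel_measurable_ray_moment[OF fin])
  have [measurable]: "g v j \<in> borel_measurable borel" for j unfolding g_def[abs_def] by measurable
  have g_le: "\<bar>g z j x\<bar> \<le> \<bar>x\<bar>" for z j x
  proof -
    have "\<bar>g z j x\<bar> \<le> 1 * (\<bar>x\<bar> * 1)"
      unfolding g_def abs_mult using std_normal_density_le_1 abs_ray_moment_le by (intro mult_mono) auto
    then show ?thesis by simp
  qed
  have "((\<lambda>z. LINT x|lborel. std_normal_density x * (sgn x * ray_moment z U x)) has_real_derivative (LINT x|lborel. f' v x)) (at v)"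
  proof (rule has_derivative_under_integral[OF d])
    fix z x assume z: "\<bar>z - v\<bar> < \<delta>"
    have U': "finite U" "\<And>k. k \<in> U \<Longrightarrow> z < k" using U less z by auto
    show "((\<lambda>z. std_normal_density x * (sgn x * ray_moment z U x)) has_real_derivative f' z x) (at z)"
      unfolding f'_def g_def by (intro DERIV_cmult ray_moment_derivative_base U')
    show "integrable lborel (\<lambda>x. std_normal_density x * (sgn x * ray_moment z U x))"
      by (rule integrable_ray_moment[OF U', where c=1]) (auto simp: abs_sgn_eq)
    have "\<bar>\<Sum>j\<in>U. 2 * point_sign j (U - {j}) / (sinh (j - z) * tanh (j - z)) * g z j x\<bar> \<le> (\<Sum>j\<in>U. K * \<bar>x\<bar>)"
    proof (intro order_trans[OF sum_abs] sum_mono)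
      fix j assume j: "j \<in> U"
      have "sinh \<delta> \<le> sinh (j - z)" "tanh \<delta> \<le> tanh (j - z)" using far[OF j z] by auto
      then have "sinh \<delta> * tanh \<delta> \<le> sinh (j - z) * tanh (j - z)"
        using d by (intro mult_mono) (auto intro: order_trans[rotated])
      moreover have "0 < sinh \<delta> * tanh \<delta>" using d by simp
      ultimately have "2 * \<bar>point_sign j (U - {j})\<bar> / (sinh (j - z) * tanh (j - z)) \<le> K"
        unfolding K_def using point_sign_le[of j "U - {j}"] by (intro frac_le) auto
      moreover have "0 < sinh (j - z)" "0 < tanh (j - z)" using less[OF j z] by auto
      ultimately show "\<bar>2 * point_sign j (U - {j}) / (sinh (j - z) * tanh (j - z)) * g z j x\<bar> \<le> K * \<bar>x\<bar>"
        unfolding abs_mult[of _ "g z j x"] using g_le[of z j x] d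
        by (intro mult_mono) (auto simp: abs_mult abs_of_pos K_def)
    qed
    then have "\<bar>f' z x\<bar> \<le> std_normal_density x * (1 * (\<Sum>j\<in>U. K * \<bar>x\<bar>))"
      unfolding f'_def abs_mult[of "std_normal_density x"] abs_mult[of "sgn x"]
      by (intro mult_mono) (auto simp: abs_sgn_eq)
    then show "\<bar>f' z x\<bar> \<le> (real (card U) * K) * (std_normal_density x * \<bar>x\<bar> ^ 1)"
      by (simp add: mult_ac)
  next
    show "f' v \<in> borel_measurable lborel" unfolding f'_def[abs_def] by measurable
    show "integrable lborel (\<lambda>x. (real (card U) * K) * (std_normal_density x * \<bar>x\<bar> ^ 1))"
      by (intro integrable_mult_right integrable_std_normal_moment_abs)
  qed
  also have "(LINT x|lborel. f' v x) = (LINT x|lborel.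
     (\<Sum>j\<in>U. 2 * point_sign j (U - {j}) / (sinh (j - v) * tanh (j - v)) * (std_normal_density x * (sgn x * g v j x))))"
    unfolding f'_def sum_distrib_left by (intro Bochner_Integration.integral_cong sum.cong) auto
  also have "\<dots> = (\<Sum>j\<in>U. 2 * point_sign j (U - {j}) / (sinh (j - v) * tanh (j - v)) *
     (LINT x|lborel. std_normal_density x * (sgn x * g v j x)))"
  proof (subst Bochner_Integration.integral_sum[OF integrable_mult_right])
    show "integrable lborel (\<lambda>x. std_normal_density x * (sgn x * g v j x))" for j
    proof (rule Bochner_Integration.integrable_bound[OF integrable_std_normal_moment_abs[of 1]])
      show "AE x in lborel. norm (std_normal_density x * (sgn x * g v j x)) \<le> norm (std_normal_density x * \<bar>x\<bar> ^ 1)"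
        using g_le by (intro AE_I2) (auto simp: abs_mult abs_sgn_eq intro!: mult_left_mono)
    qed measurable
  qed simp
  also have "\<dots> = (\<Sum>j\<in>U. point_sign j (U - {j}) * (2 * std_normal_density 0 / cosh (j - v)) *
      (LINT y|lborel. std_normal_density y * (\<bar>y\<bar> * ray_moment v (U - {j}) y)))"
  proof (rule sum.cong[OF refl])
    fix j assume j: "j \<in> U"
    have b: "0 < j - v" using U(2)[OF j] by simp
    have nz: "sinh (j - v) \<noteq> 0" "tanh (j - v) > 0" using b by auto
    \<comment> \<open>Writing \<open>\<bar>x\<bar>\<close> through the rotated variable yields one
      factor \<open>tanh (j - v)\<close> and the rotation a second one; against
      \<open>sinh (j - v) * tanh (j - v)\<close> they leave \<open>1 / cosh (j - v)\<close>.\<close>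
    have "sgn x * g v j x = tanh (j - v) * (std_normal_density (x / sinh (j - v)) *
        (\<bar>- (x / tanh (j - v))\<bar> * ray_moment v (U - {j}) (- (x / tanh (j - v)))))" for x
      using nz by (simp add: g_def abs_sgn[of x] abs_divide)
    then have "(LINT x|lborel. std_normal_density x * (sgn x * g v j x)) =
       tanh (j - v) * (LINT x|lborel. std_normal_density x * (std_normal_density (x / sinh (j - v)) *
        (\<bar>- (x / tanh (j - v))\<bar> * ray_moment v (U - {j}) (- (x / tanh (j - v))))))"
      unfolding integral_mult_right_zero[symmetric] by (simp only: mult.left_commute)
    also have "\<dots> = tanh (j - v) * (std_normal_density 0 * tanh (j - v) *
        (LINT y|lborel. std_normal_density y * (\<bar>y\<bar> * ray_moment v (U - {j}) y)))"
      by (subst std_normal_integral_rotate[OF b, of "\<lambda>y. \<bar>y\<bar> * ray_moment v (U - {j}) y"]) simp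
    finally show "2 * point_sign j (U - {j}) / (sinh (j - v) * tanh (j - v)) * (LINT x|lborel. std_normal_density x * (sgn x * g v j x)) =
      point_sign j (U - {j}) * (2 * std_normal_density 0 / cosh (j - v)) * (LINT y|lborel. std_normal_density y * (\<bar>y\<bar> * ray_moment v (U - {j}) y))"
      using nz by (simp add: tanh_def)
  qed
  also have "\<dots> = (\<Sum>j\<in>U. 2 / pi * point_sign j (U - {j}) * sgn_moment (U - {j}) (\<lambda>_. 0) / cosh (j - v)) -
     (\<Sum>j\<in>U. \<Sum>i\<in>U - {j}. 2 / pi * (point_sign j (U - {j}) * point_sign i (U - {j} - {i})) * ray_integral v (U - {j} - {i}) / (cosh (j - v) * cosh (i - v)))"
  proof -
    \<comment> \<open>Integration by parts for \<open>U - {j}\<close>: the boundary term gives the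
      claimed derivative, the sum gives the terms in which \<open>v\<close>, \<open>j\<close> and
      \<open>i\<close> interact.\<close>
    have J: "(LINT y|lborel. std_normal_density y * (\<bar>y\<bar> * ray_moment v (U - {j}) y)) = 2 * std_normal_density 0 * sgn_moment (U - {j}) (\<lambda>_. 0)
       - (\<Sum>i\<in>U - {j}. point_sign i (U - {j} - {i}) * (2 * std_normal_density 0 / cosh (i - v)) * ray_integral v (U - {j} - {i}))" for j
      by (rule ray_moment_abs_integral) (use fin in auto)
    show ?thesis
      unfolding J std_normal_density_0_square[symmetric] power2_eq_square
        sum_subtractf[symmetric] right_diff_distrib sum_distrib_left
      by (intro sum.cong arg_cong2[of _ _ _ _ "(-)"] refl) (auto simp: mult_ac)
  qed
  also have "(\<Sum>j\<in>U. \<Sum>i\<in>U - {j}. 2 / pi * (point_sign j (U - {j}) * point_sign i (U - {j} - {i})) * ray_integral v (U - {j} - {i}) / (cosh (j - v) * cosh (i - v))) = 0"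
  proof (rule sum_antisymmetric_zero[OF U(1)])
    fix i j assume ij: "i \<in> U" "j \<in> U" "i \<noteq> j"
    \<comment> \<open>Removing the two points in either order differs only in the factor comparing
      them, \<open>sgn (j - i)\<close> against \<open>sgn (i - j)\<close>.\<close>
    have "point_sign i (U - {i}) = sgn (j - i) * point_sign i (U - {i} - {j})"
      "point_sign j (U - {j}) = sgn (i - j) * point_sign j (U - {j} - {i})"
      unfolding point_sign_def using ij U(1) by (auto intro: prod.remove)
    moreover have "U - {i} - {j} = U - {j} - {i}" by auto
    moreover have "sgn (j - i) = - sgn (i - j)" by (simp add: sgn_if)
    ultimately show "2 / pi * (point_sign i (U - {i}) * point_sign j (U - {i} - {j})) * ray_integral v (U - {i} - {j}) / (cosh (i - v) * cosh (j - v)) =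
       - (2 / pi * (point_sign j (U - {j}) * point_sign i (U - {j} - {i})) * ray_integral v (U - {j} - {i}) / (cosh (j - v) * cosh (i - v)))"
      by (simp add: mult_ac)
  qed
  finally show ?thesis unfolding ray_integral_def by simp
qed

text \<open>Far to the left the point decorrelates from \<open>U\<close>: the thresholds tend to 0,
  the moment becomes independent of \<open>y\<close>, and the odd factor \<open>sgn y\<close>
  integrates to zero against the even density.\<close>

lemma ray_integral_tendsto_0:
  assumes U: "finite U"
  shows "(\<lambda>n. ray_integral (- real n) U) \<longlonglongrightarrow> 0"
proof -
  have lim: "(\<lambda>n. ray_moment (- real n) U y) \<longlonglongrightarrow> sgn_moment U (\<lambda>_. 0)" for y
    unfolding ray_moment_def
  proof (rule sgn_moment_tendsto[OF U])
    fix k :: real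
    show "(\<lambda>n. - y / sinh (k - - real n)) \<longlonglongrightarrow> 0" by real_asymp
  qed
  have ev: "eventually (\<lambda>n. \<forall>k\<in>U. - real n < k) sequentially"
    using U by (auto simp: eventually_ball_finite_distrib) real_asymp
  then obtain n0 where n0: "\<And>n k. n \<ge> n0 \<Longrightarrow> k \<in> U \<Longrightarrow> - real n < k"
    by (auto simp: eventually_sequentially)
  have "(\<lambda>n. ray_integral (- real (n + n0)) U) \<longlonglongrightarrow> (LINT y|lborel. std_normal_density y * (sgn y * sgn_moment U (\<lambda>_. 0)))"
    unfolding ray_integral_def
  proof (rule integral_dominated_convergence[where w=std_normal_density])
    show "(\<lambda>y. std_normal_density y * (sgn y * ray_moment (- real (n + n0)) U y)) \<in> borel_measurable lborel" for n
    proof -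
      have [measurable]: "ray_moment (- real (n + n0)) U \<in> borel_measurable borel"
        by (rule borel_measurable_ray_moment[OF U n0]) auto
      show ?thesis by measurable
    qed
    show "AE y in lborel. (\<lambda>n. std_normal_density y * (sgn y * ray_moment (- real (n + n0)) U y)) \<longlonglongrightarrow> std_normal_density y * (sgn y * sgn_moment U (\<lambda>_. 0))"
      by (intro AE_I2 tendsto_intros LIMSEQ_ignore_initial_segment[OF lim])
    show "AE y in lborel. norm (std_normal_density y * (sgn y * ray_moment (- real (n + n0)) U y)) \<le> std_normal_density y" for n
      by (intro AE_I2) (auto simp: abs_mult abs_sgn_eq abs_ray_moment_le intro: mult_left_le)
  qed auto
  also have "(LINT y|lborel. std_normal_density y * (sgn y * sgn_moment U (\<lambda>_. 0))) = 0"
  proof -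
    let ?I = "LINT y|lborel. std_normal_density y * (sgn y * sgn_moment U (\<lambda>_. 0))"
    have "?I = (LINT y|lborel. std_normal_density (- y) * (sgn (- y) * sgn_moment U (\<lambda>_. 0)))"
      by (subst lborel_integral_real_affine[where c="-1" and t=0]) auto
    also have "\<dots> = (LINT y|lborel. - (std_normal_density y * (sgn y * sgn_moment U (\<lambda>_. 0))))"
      by (intro Bochner_Integration.integral_cong) (auto simp: normal_density_def)
    finally show ?thesis by simp
  qed
  finally show ?thesis by (rule LIMSEQ_offset)
qed

proposition sgn_moment_recursion:
  assumes U: "finite U" "\<And>k. k \<in> U \<Longrightarrow> v < k"
  shows "sgn_moment (insert v U) (\<lambda>_. 0) =
    2 / pi * (\<Sum>j\<in>U. point_sign j (U - {j}) * arcsin (1 / cosh (j - v)) * sgn_moment (U - {j}) (\<lambda>_. 0))"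
proof -
  define H where "H z = (\<Sum>j\<in>U. 2 / pi * point_sign j (U - {j}) * sgn_moment (U - {j}) (\<lambda>_. 0) * arcsin (1 / cosh (j - z)))" for z
  \<comment> \<open>Being convex, this set forces the difference to be constant; it contains
    \<open>v\<close> and eventually every \<open>- real n\<close>, so the constant can be read off
    at -\<infinity>.\<close>
  let ?S = "{z. \<forall>k\<in>U. z < k}"
  have "convex ?S" by (auto simp: convex_def intro: convex_bound_lt)
  moreover have "((\<lambda>z. ray_integral z U - H z) has_real_derivative 0) (at z within ?S)" if "z \<in> ?S" for z
  proof -
    have "(H has_real_derivative (\<Sum>j\<in>U. 2 / pi * point_sign j (U - {j}) * sgn_moment (U - {j}) (\<lambda>_. 0) * (1 / cosh (j - z)))) (at z)"
      unfolding H_def[abs_def] using that by (intro DERIV_sum DERIV_cmult arcsin_sech_derivative) auto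
    with ray_integral_derivative[OF U(1), of z] that have "((\<lambda>z. ray_integral z U - H z) has_real_derivative
       (\<Sum>j\<in>U. 2 / pi * point_sign j (U - {j}) * sgn_moment (U - {j}) (\<lambda>_. 0) / cosh (j - z)) -
       (\<Sum>j\<in>U. 2 / pi * point_sign j (U - {j}) * sgn_moment (U - {j}) (\<lambda>_. 0) * (1 / cosh (j - z)))) (at z)"
      by (intro DERIV_diff) auto
    then show ?thesis by (simp add: has_field_derivative_at_within)
  qed
  ultimately obtain c where c: "\<And>z. z \<in> ?S \<Longrightarrow> ray_integral z U - H z = c"
    using has_field_derivative_zero_constant[of ?S "\<lambda>z. ray_integral z U - H z"] by blast
  have "(\<lambda>n. arcsin (1 / cosh (j - - real n))) \<longlonglongrightarrow> 0" for j
  proof -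
    have "(\<lambda>n. 1 / cosh (j - - real n)) \<longlonglongrightarrow> 0" by real_asymp
    then have "(\<lambda>n. arcsin (1 / cosh (j - - real n))) \<longlonglongrightarrow> arcsin 0"
      by (rule isCont_tendsto_compose[OF isCont_arcsin, rotated 2]) auto
    then show ?thesis by simp
  qed
  then have "(\<lambda>n. H (- real n)) \<longlonglongrightarrow> (\<Sum>j\<in>U. 2 / pi * point_sign j (U - {j}) * sgn_moment (U - {j}) (\<lambda>_. 0) * 0)"
    unfolding H_def by (intro tendsto_intros)
  then have "(\<lambda>n. ray_integral (- real n) U - H (- real n)) \<longlonglongrightarrow> 0"
    using tendsto_diff[OF ray_integral_tendsto_0[OF U(1)]] by fastforce
  moreover have "eventually (\<lambda>n. \<forall>k\<in>U. - real n < k) sequentially"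
    using U(1) by (auto simp: eventually_ball_finite_distrib) real_asymp
  then have "eventually (\<lambda>n. ray_integral (- real n) U - H (- real n) = c) sequentially"
    by eventually_elim (auto intro: c)
  then have "(\<lambda>n. ray_integral (- real n) U - H (- real n)) \<longlonglongrightarrow> c"
    by (rule tendsto_eventually)
  ultimately have "c = 0" by (rule LIMSEQ_unique[rotated])
  then have "ray_integral v U = H v" using c[of v] U(2) by simp
  moreover have "sgn_moment (insert v U) (\<lambda>_. 0) = ray_integral v U" by (rule sgn_moment_insert_zero) (use U in auto)
  ultimately show ?thesis
    unfolding H_def sum_distrib_left by (simp add: mult_ac)
qed

end

section \<open>The Pfaffian formula\<close>

text \<open>\<open>c_kernel\<close> is the correlation coefficient of two values of the power
  series, so it must agree with the covariance of the normalised process.\<close>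

lemma c_kernel_tanh: "c_kernel (tanh a) (tanh b) = 1 / cosh (a - b)"
proof -
  have t: "1 - (tanh x)\<^sup>2 = (1 / cosh x)\<^sup>2" for x :: real
  proof -
    have "1 - (tanh x)\<^sup>2 = ((cosh x)\<^sup>2 - (sinh x)\<^sup>2) / (cosh x)\<^sup>2"
      by (simp add: tanh_def power_divide diff_divide_distrib)
    then show ?thesis by (simp only: hyperbolic_pythagoras power_divide power_one)
  qed
  have "sqrt ((1 - (tanh a)\<^sup>2) * (1 - (tanh b)\<^sup>2)) = 1 / (cosh a * cosh b)"
    unfolding t power_mult_distrib[symmetric] by (simp add: abs_mult)
  then show ?thesis
    unfolding c_kernel_def using inverse_cosh_diff[of a b] by simp
qed

lemma K22_tanh: "K22 (tanh a) (tanh b) = sgn (b - a) * arcsin (1 / cosh (b - a))"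
proof -
  have "sgn (tanh b - tanh a) = sgn (b - a)" by (simp add: sgn_if)
  moreover have "cosh (a - b) = cosh (b - a)" by (metis cosh_minus minus_diff_eq)
  ultimately show ?thesis by (simp only: K22_def c_kernel_tanh)
qed

lemma ex_tanh_eq:
  fixes x :: real
  assumes "-1 < x" "x < 1"
  shows "\<exists>u. tanh u = x"
proof -
  \<comment> \<open>Its logarithm is the inverse hyperbolic tangent of \<open>x\<close>.\<close>
  let ?y = "sqrt ((1 + x) / (1 - x))"
  have "0 < ?y" using assms by simp
  moreover have "?y ^ 2 = (1 + x) / (1 - x)" using assms by simp
  ultimately have "tanh (ln ?y) = ((1 + x) / (1 - x) - 1) / ((1 + x) / (1 - x) + 1)"
    by (simp add: tanh_ln_real)
  also have "\<dots> = x" using assms by (simp add: divide_simps)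
  finally show ?thesis by blast
qed

definition vandermonde_sgn :: "(nat \<Rightarrow> real) \<Rightarrow> nat set \<Rightarrow> real" where
  "vandermonde_sgn t S = (\<Prod>(i, j)\<in>{(i, j). i \<in> S \<and> j \<in> S \<and> i < j}. sgn (t j - t i))"

text \<open>The pairs containing \<open>p\<close> are oriented by index. Rewriting each as
  \<open>sgn (t k - t p)\<close> flips the factor exactly when \<open>k < p\<close>, and these flips
  make up \<open>index_sign p (S - {p})\<close>.\<close>

lemma vandermonde_sgn_remove:
  assumes "finite S" "p \<in> S" "inj_on t S"
  shows "vandermonde_sgn t S = index_sign p (S - {p}) * (\<Prod>k\<in>S - {p}. sgn (t k - t p)) * vandermonde_sgn t (S - {p})"
proof -
  let ?P = "\<lambda>S. {(i, j). i \<in> S \<and> j \<in> S \<and> i < (j::nat)}"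
  let ?f = "\<lambda>k. if k < p then (k, p) else (p, k)"
  have fin: "finite (?P S)" if "finite S" for S :: "nat set"
    by (rule finite_subset[of _ "S \<times> S"]) (use that in auto)
  have split: "?P S = ?P (S - {p}) \<union> ?f ` (S - {p})"
    using assms(2) by (auto simp: image_iff split: if_splits)
  have "vandermonde_sgn t S = vandermonde_sgn t (S - {p}) * (\<Prod>(i, j)\<in>?f ` (S - {p}). sgn (t j - t i))"
    unfolding vandermonde_sgn_def split using assms(1)
    by (intro prod.union_disjoint fin) (auto split: if_splits)
  also have "(\<Prod>(i, j)\<in>?f ` (S - {p}). sgn (t j - t i)) = (\<Prod>k\<in>S - {p}. (if k < p then -1 else 1) * sgn (t k - t p))"
    by (subst prod.reindex) (auto intro!: inj_onI prod.cong split: if_splits simp: sgn_if)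
  finally show ?thesis by (simp add: index_sign_def prod.distrib)
qed

lemma vandermonde_sgn_insert_min:
  assumes "finite S" "p \<in> S" "inj_on t S" "\<And>k. k \<in> S - {p} \<Longrightarrow> t p < t k"
  shows "vandermonde_sgn t S = index_sign p (S - {p}) * vandermonde_sgn t (S - {p})"
  using vandermonde_sgn_remove[OF assms(1-3)] assms(4) by simp

context sech_process
begin

text \<open>Removing the smallest point \<open>u p\<close> and a partner \<open>u j\<close> changes
  the moment by \<open>sgn_moment_recursion\<close>, the Pfaffian by expansion along row
  \<open>p\<close>, and \<open>vandermonde_sgn\<close> by the signs in which the other two
  differ.\<close>

proposition sgn_moment_eq_pfaffian_set:
  assumes "finite S" "card S = 2 * n" "inj_on u S"
  shows "sgn_moment (u ` S) (\<lambda>_. 0) = (2 / pi) ^ n * vandermonde_sgn u S * pfaffian_set n (\<lambda>i j. K22 (tanh (u i)) (tanh (u j))) S"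
  using assms
proof (induction n arbitrary: S)
  case 0
  then show ?case by (simp add: sgn_moment_def vandermonde_sgn_def prob_space)
next
  case (Suc n)
  let ?K = "\<lambda>i j. K22 (tanh (u i)) (tanh (u j))"
  obtain p where p: "p \<in> S" "\<And>k. k \<in> S \<Longrightarrow> u p \<le> u k"
    using Suc.prems(1,2) arg_min_if_finite[of S u] by (metis card.empty mult_is_0 nat.distinct(1) not_le zero_neq_numeral)
  let ?R = "S - {p}"
  have less: "u p < u k" if "k \<in> ?R" for k
    using p(2)[of k] that p(1) inj_onD[OF Suc.prems(3), of p k] by force
  have injR: "inj_on u ?R" using Suc.prems(3) by (rule inj_on_diff)
  have img: "u ` S = insert (u p) (u ` ?R)" using p(1) by auto
  have skew: "?K j i = - ?K i j" for i j
  proof -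
    have "sgn (tanh (u i) - tanh (u j)) = - sgn (tanh (u j) - tanh (u i))" by (simp add: sgn_if)
    then show ?thesis by (simp add: K22_def c_kernel_def mult.commute)
  qed
  have "sgn_moment (u ` S) (\<lambda>_. 0) = 2 / pi * (\<Sum>w\<in>u ` ?R. point_sign w (u ` ?R - {w}) * arcsin (1 / cosh (w - u p)) * sgn_moment (u ` ?R - {w}) (\<lambda>_. 0))"
    unfolding img by (rule sgn_moment_recursion) (use Suc.prems less in auto)
  also have "\<dots> = 2 / pi * (\<Sum>j\<in>?R. point_sign (u j) (u ` ?R - {u j}) * arcsin (1 / cosh (u j - u p)) * sgn_moment (u ` ?R - {u j}) (\<lambda>_. 0))"
    by (subst sum.reindex[OF injR]) simp
  also have "\<dots> = (\<Sum>j\<in>?R. (2 / pi) ^ Suc n * vandermonde_sgn u S * (index_sign p ?R * index_sign j (S - {p, j}) * ?K p j * pfaffian_set n ?K (S - {p, j})))"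
    unfolding sum_distrib_left
  proof (rule sum.cong[OF refl])
    fix j assume j: "j \<in> ?R"
    let ?T = "S - {p, j}"
    have T: "?R - {j} = ?T" by auto
    have imgT: "u ` ?R - {u j} = u ` ?T" using injR j by (auto simp: inj_on_def)
    have injT: "inj_on u ?T" using Suc.prems(3) by (rule inj_on_diff)
    have e: "point_sign (u j) (u ` ?T) = (\<Prod>k\<in>?T. sgn (u k - u j))"
      unfolding point_sign_def by (subst prod.reindex[OF injT]) simp
    have IH: "sgn_moment (u ` ?T) (\<lambda>_. 0) = (2 / pi) ^ n * vandermonde_sgn u ?T * pfaffian_set n ?K ?T"
      using Suc.prems p j injT by (intro Suc.IH) (auto simp: card_Diff_subset)
    have K: "?K p j = arcsin (1 / cosh (u j - u p))"
      using less[OF j] by (simp add: K22_tanh)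
    \<comment> \<open>\<open>p\<close> contributes only \<open>index_sign\<close>, since
      \<open>u p\<close> lies below all other points; \<open>j\<close> contributes
      \<open>index_sign\<close> and the \<open>point_sign\<close> of the recursion.\<close>
    have V: "vandermonde_sgn u S = index_sign p ?R * (index_sign j ?T * point_sign (u j) (u ` ?T) * vandermonde_sgn u ?T)"
      using vandermonde_sgn_insert_min[OF Suc.prems(1) p(1) Suc.prems(3) less]
        vandermonde_sgn_remove[of ?R j u] Suc.prems(1) j injR unfolding T e by simp
    have sq: "index_sign a A * (index_sign a A * x) = x" for a A x
      using index_sign_square[of a A] by (simp add: mult.assoc[symmetric])
    show "2 / pi * (point_sign (u j) (u ` ?R - {u j}) * arcsin (1 / cosh (u j - u p)) * sgn_moment (u ` ?R - {u j}) (\<lambda>_. 0)) =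
      (2 / pi) ^ Suc n * vandermonde_sgn u S * (index_sign p ?R * index_sign j ?T * ?K p j * pfaffian_set n ?K ?T)"
    proof -
      have "vandermonde_sgn u S * (index_sign p ?R * index_sign j ?T * ?K p j * pfaffian_set n ?K ?T) =
         index_sign p ?R * (index_sign p ?R * (index_sign j ?T * (index_sign j ?T * (point_sign (u j) (u ` ?T) * vandermonde_sgn u ?T * ?K p j * pfaffian_set n ?K ?T))))"
        unfolding V by (simp only: mult_ac)
      also have "\<dots> = point_sign (u j) (u ` ?T) * vandermonde_sgn u ?T * ?K p j * pfaffian_set n ?K ?T"
        by (simp only: sq)
      finally have "(2 / pi) ^ Suc n * (point_sign (u j) (u ` ?T) * vandermonde_sgn u ?T * ?K p j * pfaffian_set n ?K ?T) =
          (2 / pi) ^ Suc n * (vandermonde_sgn u S * (index_sign p ?R * index_sign j ?T * ?K p j * pfaffian_set n ?K ?T))"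
        by (simp only:)
      then show ?thesis unfolding imgT IH K[symmetric] by (simp only: power_Suc mult_ac)
    qed
  qed
  also have "\<dots> = (2 / pi) ^ Suc n * vandermonde_sgn u S * pfaffian_set (Suc n) ?K S"
    unfolding sum_distrib_left[symmetric]
    by (subst pfaffian_set_expand[OF skew Suc.prems(1,2) p(1)]) simp
  finally show ?case .
qed

end

text \<open>Every pair of an admissible permutation is increasing, so only entries above the
  diagonal are read. This identifies the kernel matrix with the one built from its upper
  triangle.\<close>

lemma pfaffian_cong:
  assumes "\<And>i j. 1 \<le> i \<Longrightarrow> i < j \<Longrightarrow> j \<le> 2 * n \<Longrightarrow> A i j = B i j"
  shows "pfaffian n A = pfaffian n B"
  unfolding pfaffian_def
proof (intro sum.cong refl arg_cong2[of _ _ _ _ "(*)"] prod.cong)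
  fix \<eta> i assume \<eta>: "\<eta> \<in> pfaffian_perms n" and i: "i \<in> {1..n}"
  then have perm: "\<eta> permutes {1..2 * n}" and less: "\<eta> (2 * i - 1) < \<eta> (2 * i)"
    unfolding pfaffian_perms_def by blast+
  have "2 * i - 1 \<in> {1..2 * n}" "2 * i \<in> {1..2 * n}" using i by auto
  then have "\<eta> (2 * i - 1) \<in> {1..2 * n}" "\<eta> (2 * i) \<in> {1..2 * n}"
    using permutes_in_image[OF perm] by blast+
  then show "A (\<eta> (2 * i - 1)) (\<eta> (2 * i)) = B (\<eta> (2 * i - 1)) (\<eta> (2 * i))"
    using less by (intro assms) auto
qed

theorem theorem2p6:
  fixes M :: "'w measure" and a :: "nat \<Rightarrow> 'w \<Rightarrow> real" and n :: nat
  assumes "prob_space M"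
    and "prob_space.indep_vars M (\<lambda>_. borel) a UNIV"
    and "\<And>k. distributed M lborel (a k) (\<lambda>x. ennreal (std_normal_density x))"
    and "n \<ge> 1"
  shows "(\<forall>t :: nat \<Rightarrow> real. (\<forall>i\<in>{1..2 * n}. t i \<in> {-1<..<1}) \<and> inj_on t {1..2 * n} \<longrightarrow>
            (LINT \<omega>|M. (\<Prod>i=1..2 * n. sgn (random_power_series a \<omega> (t i)))) =
            (2 / pi) ^ n *
            (\<Prod>(i, j)\<in>{(i, j). 1 \<le> i \<and> i < j \<and> j \<le> 2 * n}. sgn (t j - t i)) *
            pfaffian n (\<lambda>i j. K22 (t i) (t j))) \<and>
         (\<forall>t :: nat \<Rightarrow> real. (\<forall>i\<in>{1..2 * n}. t i \<in> {-1<..<1}) \<and> strict_mono_on {1..2 * n} t \<longrightarrow>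
            (LINT \<omega>|M. (\<Prod>i=1..2 * n. sgn (random_power_series a \<omega> (t i)))) =
            (2 / pi) ^ n * pfaffian_upper n (\<lambda>i j. arcsin (c_kernel (t i) (t j))))"
proof -
  interpret sech_process M "\<lambda>u \<omega>. random_power_series a \<omega> (tanh u) / cosh u"
    by (rule sech_process_power_series) fact+
  have general: "(LINT \<omega>|M. (\<Prod>i=1..2 * n. sgn (random_power_series a \<omega> (t i)))) =
            (2 / pi) ^ n *
            (\<Prod>(i, j)\<in>{(i, j). 1 \<le> i \<and> i < j \<and> j \<le> 2 * n}. sgn (t j - t i)) *
            pfaffian n (\<lambda>i j. K22 (t i) (t j))"
    if t: "\<And>i. i \<in> {1..2 * n} \<Longrightarrow> t i \<in> {-1<..<1}" and inj: "inj_on t {1..2 * n}" for t :: "nat \<Rightarrow> real"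
  proof -
    have "\<forall>i\<in>{1..2 * n}. \<exists>u. tanh u = t i"
      using t by (auto intro!: ex_tanh_eq)
    then obtain u where tu: "\<And>i. i \<in> {1..2 * n} \<Longrightarrow> tanh (u i) = t i"
      by metis
    have injU: "inj_on u {1..2 * n}" using inj tu by (metis inj_on_def)
    \<comment> \<open>Dividing by \<open>cosh (u i) > 0\<close> does not change signs, and
      injectivity of \<open>u\<close> turns the product over indices into one over points.\<close>
    have "(LINT \<omega>|M. (\<Prod>i=1..2 * n. sgn (random_power_series a \<omega> (t i)))) = sgn_moment (u ` {1..2 * n}) (\<lambda>_. 0)"
      unfolding sgn_moment_def
      by (intro Bochner_Integration.integral_cong refl, subst prod.reindex[OF injU]) (simp add: sgn_divide tu)
    also have "\<dots> = (2 / pi) ^ n * vandermonde_sgn u {1..2 * n} * pfaffian_set n (\<lambda>i j. K22 (tanh (u i)) (tanh (u j))) {1..2 * n}"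
      by (rule sgn_moment_eq_pfaffian_set) (use injU in auto)
    also have "pfaffian_set n (\<lambda>i j. K22 (tanh (u i)) (tanh (u j))) {1..2 * n} = pfaffian n (\<lambda>i j. K22 (t i) (t j))"
      unfolding pfaffian_eq_pfaffian_set[symmetric] by (rule pfaffian_cong) (simp add: tu)
    also have "vandermonde_sgn u {1..2 * n} = (\<Prod>(i, j)\<in>{(i, j). 1 \<le> i \<and> i < j \<and> j \<le> 2 * n}. sgn (t j - t i))"
      unfolding vandermonde_sgn_def
    proof (rule prod.cong)
      fix z assume "z \<in> {(i, j). 1 \<le> i \<and> i < j \<and> j \<le> 2 * n}"
      then obtain i j where ij: "z = (i, j)" "i \<in> {1..2 * n}" "j \<in> {1..2 * n}" by auto
      have "sgn (tanh (u j) - tanh (u i)) = sgn (u j - u i)" by (simp add: sgn_if)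
      then show "(case z of (i, j) \<Rightarrow> sgn (u j - u i)) = (case z of (i, j) \<Rightarrow> sgn (t j - t i))"
        using ij by (simp add: tu)
    qed auto
    finally show ?thesis .
  qed
  have "(LINT \<omega>|M. (\<Prod>i=1..2 * n. sgn (random_power_series a \<omega> (t i)))) =
            (2 / pi) ^ n * pfaffian_upper n (\<lambda>i j. arcsin (c_kernel (t i) (t j)))"
    if t: "\<And>i. i \<in> {1..2 * n} \<Longrightarrow> t i \<in> {-1<..<1}" and mono: "strict_mono_on {1..2 * n} t" for t :: "nat \<Rightarrow> real"
  proof -
    have pos: "sgn (t j - t i) = 1" if "1 \<le> i" "i < j" "j \<le> 2 * n" for i j
      using strict_mono_onD[OF mono, of i j] that by simp
    have "(\<Prod>(i, j)\<in>{(i, j). 1 \<le> i \<and> i < j \<and> j \<le> 2 * n}. sgn (t j - t i)) = 1"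
      by (rule prod.neutral) (auto simp: pos)
    moreover have "pfaffian n (\<lambda>i j. K22 (t i) (t j)) = pfaffian_upper n (\<lambda>i j. arcsin (c_kernel (t i) (t j)))"
      unfolding pfaffian_upper_def by (rule pfaffian_cong) (simp add: skew_of_upper_def K22_def pos)
    ultimately show ?thesis
      using general[OF t strict_mono_on_imp_inj_on[OF mono]] by simp
  qed
  with general show ?thesis by blast
qed

end
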